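(* Assume $Y_i=g(V_i;\theta^* )+W_i$, $i=1,\dots,n$, where $W\sim\mathcal N(\mathbf 0_n,\sigma^2\boldsymbol I_n)$ is independent of $V$. Then for any $q\in[1,\infty]$ and any $t\ge0$, $$\mathbb P\Big\{\Big\Vert\tfrac1nX^TW\Big\Vert_q\ge\mathbb E_W\Big[\Big\Vert\tfrac1nX^TW\Big\Vert_q\Big]+t\Big\}\le\exp\left(\frac{-nt^2}{2\sigma^2\Big\Vert\sqrt{\frac1n\sum_{i=1}^nX_i^2}\Big\Vert_q^2}\right).$$ Moreover, for $\alpha\in(0,1)$, let $$r^*_{\alpha,q}:=\mathbb E_W\Big[\Big\Vert\tfrac1nX^TW\Big\Vert_q\Big]+\sigma\Big\Vert\sqrt{\tfrac1n\sum_{i=1}^nX_i^2}\Big\Vert_q\sqrt{\tfrac2n\log\tfrac1\alpha}.$$ Then an optimal solution $(\hat\theta^*_\alpha,\hat\mu^*_\alpha)$ of the program $$\min_{(\theta,\mu)\in\mathbb R^p\times\mathbb R}\mu\quad\text{subject to}\quad\Big\Vert\tfrac1n\sum_{i=1}^nX_i[Y_i-g(V_i;\theta)]\Big\Vert_q\le r^*_{\alpha,q}+\mu,\quad h(\theta)\in\Omega,\quad\mu\ge0,$$ must satisfy, with probability at least $1-\alpha$, $$\Big\Vert\tfrac1n\sum_{i=1}^nX_i[g(V_i;\theta^* )-g(V_i;\hat\theta^*_\alpha)]\Big\Vert_q\ge\hat\mu^*_\alpha,$$ $$\Big\Vert\tfrac1n\sum_{i=1}^nX_i[g(V_i;\theta^*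 )-g(V_i;\hat\theta^*_\alpha)]\Big\Vert_q\le2r^*_{\alpha,q}+\hat\mu^*_\alpha.$$
   Context: Setting: $Y=(Y_i)_{i=1}^n$ is the vector of real responses, $V\in\mathbb R^{n\times k}$ is the covariate matrix with rows $V_i$, $\theta^*\in\mathbb R^p$ is an unknown coefficient vector, and $g(\cdot;\cdot)$ is a known real-valued function, possibly nonlinear in $\theta$. There is no restriction on the relative sizes of $p,k,n$, and $\sigma>0$. Everything is conditional on $V$ (i.e. $V$ may be treated as fixed); $\mathbb E_W[\cdot]$ is the expectation over $W$ only, conditional on $V$. $X_i:=f(V_i)\in\mathbb R^L$ for a pre-specified function $f$; $X\in\mathbb R^{n\times L}$ is the matrix with rows $X_i$ and entries $X_{ij}$. $\Vert\cdot\Vert_q$ is the usual $\ell_q$-norm on $\mathbb R^L$. $h:\mathbb R^p\to\mathbb R^m$ is a given (possibly nonlinear) function, $\Omega\subseteq\mathbb R^m$ is nonempty and closed, and $\{\theta\in\mathbb R^p:h(\theta)\in\Omega\}$ is assumed nonempty. It is not assumed that $h(\theta^* )\in\Omega$. Notation: $\Big\Vert\sqrt{\frac1n\sum_{i=1}^nX_i^2}\Big\Vert_q$ denotes $\Big(\sum_{j=1}^L\big(\frac1n\sum_{i=1}^nX_{ij}^2\big)^{q/2}\Big)^{1/q}$ for $q\in[1,\infty)$ and $\max_{1\le j\le L}\sqrt{\frac1n\sum_{i=1}^nX_{ij}^2}$ for $q=\infty$. *)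

theory Defs
  imports "HOL-Probability.Probability"
begin

text \<open>Used for exponents \<open>q \<in> [1, \<infinity>]\<close>.\<close>

definition lq_norm :: "ereal \<Rightarrow> real ^ 'l \<Rightarrow> real" where
  "lq_norm q x =
     (if q = \<infinity> then Max (range (\<lambda>j. \<bar>x $ j\<bar>))
      else (\<Sum>j\<in>UNIV. \<bar>x $ j\<bar> powr real_of_ereal q) powr (1 / real_of_ereal q))"

definition column_rms :: "real ^ 'l ^ 'n \<Rightarrow> real ^ 'l" where
  "column_rms X = (\<chi> j. sqrt ((1 / real CARD('n)) * (\<Sum>i\<in>UNIV. (X $ i $ j)\<^sup>2)))"

text \<open>Density of the nondegenerate multivariate normal law with mean \<open>m\<close> and (positive
  definite) covariance matrix \<open>S\<close>, with respect to Lebesgue measure.\<close>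

definition mv_normal_density :: "real ^ 'n \<Rightarrow> real ^ 'n ^ 'n \<Rightarrow> real ^ 'n \<Rightarrow> real" where
  "mv_normal_density m S x =
     exp (- ((x - m) \<bullet> (matrix_inv S *v (x - m))) / 2) / sqrt ((2 * pi) ^ CARD('n) * det S)"

definition noise_corr :: "ereal \<Rightarrow> real ^ 'l ^ 'n \<Rightarrow> real ^ 'n \<Rightarrow> real" where
  "noise_corr q X w = lq_norm q ((1 / real CARD('n)) *\<^sub>R (transpose X *v w))"

text \<open>With the covariates fixed, the expectation over \<open>W\<close> alone is the integral over \<open>M\<close>.\<close>

definition r_star ::
  "'a measure \<Rightarrow> ('a \<Rightarrow> real ^ 'n) \<Rightarrow> real ^ 'l ^ 'n \<Rightarrow> real \<Rightarrow> ereal \<Rightarrow> real \<Rightarrow> real" where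
  "r_star M W X \<sigma> q \<alpha> =
     (\<integral>\<omega>. noise_corr q X (W \<omega>) \<partial>M)
       + \<sigma> * lq_norm q (column_rms X) * sqrt (2 / real CARD('n) * ln (1 / \<alpha>))"

definition feasible ::
  "(real ^ 'k \<Rightarrow> real ^ 'p \<Rightarrow> real) \<Rightarrow> (real ^ 'p \<Rightarrow> real ^ 'm) \<Rightarrow> (real ^ 'm) set \<Rightarrow>
   real ^ 'k ^ 'n \<Rightarrow> real ^ 'l ^ 'n \<Rightarrow> real ^ 'n \<Rightarrow> ereal \<Rightarrow> real \<Rightarrow> (real ^ 'p) \<times> real \<Rightarrow> bool" where
  "feasible g h \<Omega> V X y q r = (\<lambda>(\<theta>, \<mu>).
     lq_norm q ((1 / real CARD('n)) *\<^sub>R (\<Sum>i\<in>UNIV. (y $ i - g (V $ i) \<theta>) *\<^sub>R X $ i)) \<le> r + \<mu>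
     \<and> h \<theta> \<in> \<Omega> \<and> \<mu> \<ge> 0)"

definition optimal_solution ::
  "(real ^ 'k \<Rightarrow> real ^ 'p \<Rightarrow> real) \<Rightarrow> (real ^ 'p \<Rightarrow> real ^ 'm) \<Rightarrow> (real ^ 'm) set \<Rightarrow>
   real ^ 'k ^ 'n \<Rightarrow> real ^ 'l ^ 'n \<Rightarrow> real ^ 'n \<Rightarrow> ereal \<Rightarrow> real \<Rightarrow> (real ^ 'p) \<times> real \<Rightarrow> bool" where
  "optimal_solution g h \<Omega> V X y q r = is_arg_min snd (feasible g h \<Omega> V X y q r)"

end

theory Submission
  imports Defs
begin

text \<open>Write \<open>F\<close> for \<open>noise_corr q X\<close>, \<open>R\<close> for the \<open>q\<close>-norm of the column root mean squares, and
  \<open>\<gamma>\<close> for the law of \<open>W\<close>. By Minkowski and Cauchy-Schwarz, \<open>F\<close> is Lipschitz with constant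
  \<open>L = R / sqrt n\<close>, so the tail bound is Gaussian concentration with the sharp constant. This comes
  from the Prekopa-Leindler inequality: for \<open>0 < s < 1\<close> apply it to \<open>exp (- c (F - m)) d\<gamma>\<close> and
  \<open>exp (l (F - m) - k) d\<gamma>\<close> with \<open>c = s l / (1 - s)\<close>, \<open>m\<close> the mean of \<open>F\<close> and
  \<open>k = l\<^sup>2 L\<^sup>2 \<sigma>\<^sup>2 / (2 (1 - s))\<close>; strong convexity of \<open>|x|\<^sup>2\<close> makes \<open>d\<gamma>\<close> an admissible majorant.
  By Jensen the first integral is at least 1, hence the second is at most 1. Letting
  \<open>s\<close> tend to 0 gives \<open>E exp (l (F - m)) \<le> exp (l\<^sup>2 L\<^sup>2 \<sigma>\<^sup>2 / 2)\<close>, and Chernoff's bound finishes.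

  For the program, on the event \<open>F W \<le> r\<close> the pair of the optimal \<open>\<theta>\<close> and the prediction error is
  feasible, which bounds \<open>\<mu>\<close>; the upper bound is the triangle inequality.\<close>

subsection \<open>The Prekopa-Leindler inequality\<close>

text \<open>The translates \<open>A + b\<close> and \<open>a + B\<close> both lie in
  \<open>C\<close>. With \<open>a\<close> close to \<open>Sup A\<close> and \<open>b\<close> close
  to \<open>Inf B\<close> they overlap at most in an interval of length \<open>e\<close>, so their
  lengths add up to within \<open>e\<close>.\<close>

lemma brunn_minkowski_real_bounded:
  fixes A B C :: "real set"
  assumes [measurable]: "A \<in> sets borel" "B \<in> sets borel" "C \<in> sets borel"
    and ne: "A \<noteq> {}" "B \<noteq> {}" and bdd: "bdd_above A" "bdd_below B"
    and sub: "\<And>a b. a \<in> A \<Longrightarrow> b \<in> B \<Longrightarrow> a + b \<in> C"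
  shows "emeasure lborel A + emeasure lborel B \<le> emeasure lborel C"
proof (rule ennreal_le_epsilon)
  fix e :: real assume e: "0 < e"
  have "\<exists>a\<in>A. Sup A - e / 2 < a"
    using less_cSup_iff[OF ne(1) bdd(1), of "Sup A - e / 2"] e by simp
  then obtain a where a: "a \<in> A" "Sup A - e / 2 < a" by blast
  have "\<exists>b\<in>B. b < Inf B + e / 2"
    using cInf_less_iff[OF ne(2) bdd(2), of "Inf B + e / 2"] e by simp
  then obtain b where b: "b \<in> B" "b < Inf B + e / 2" by blast
  have shift: "emeasure lborel ((\<lambda>x. x - c) -` S) = emeasure lborel S"
    if "S \<in> sets borel" for S and c :: real
  proof -
    have "emeasure lborel S = emeasure (distr lborel borel ((+) (- c))) S"
      by (simp add: lborel_distr_plus)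
    also have "\<dots> = emeasure lborel ((\<lambda>x. x - c) -` S)"
      using that by (subst emeasure_distr) (auto intro!: arg_cong2[where f=emeasure])
    finally show ?thesis by simp
  qed
  define A' where "A' = (\<lambda>x. x - b) -` A"
  define B' where "B' = (\<lambda>x. x - a) -` B"
  have [measurable]: "A' \<in> sets borel" "B' \<in> sets borel"
    unfolding A'_def B'_def by (auto intro!: measurable_sets_borel[where M=borel])
  have "A' \<inter> B' \<subseteq> {Inf B + a .. Sup A + b}"
    using cSup_upper[OF _ bdd(1)] cInf_lower[OF _ bdd(2)]
    by (fastforce simp: A'_def B'_def algebra_simps)
  then have "emeasure lborel (A' \<inter> B') \<le> emeasure lborel {Inf B + a .. Sup A + b}"
    by (intro emeasure_mono) auto
  also have "\<dots> \<le> ennreal e"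
    using a b by (cases "Inf B + a \<le> Sup A + b") (auto intro!: ennreal_leI)
  finally have I: "emeasure lborel (A' \<inter> B') \<le> ennreal e" .
  have "emeasure lborel A + emeasure lborel B = emeasure lborel A' + emeasure lborel B'"
    by (simp add: A'_def B'_def shift)
  also have "\<dots> = emeasure lborel (A' \<union> B') + emeasure lborel (A' \<inter> B')"
    by (subst emeasure_Un_Int) simp_all
  also have "\<dots> \<le> emeasure lborel C + ennreal e"
  proof (intro add_mono I emeasure_mono)
    show "A' \<union> B' \<subseteq> C"
      using sub[OF _ b(1)] sub[OF a(1)] by (fastforce simp: A'_def B'_def)
  qed auto
  finally show "emeasure lborel A + emeasure lborel B \<le> emeasure lborel C + ennreal e" .
qed

text \<open>Cutting \<open>A\<close> above and \<open>B\<close> below reduces this to the bounded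
  case; continuity of measure along increasing sets removes the cuts.\<close>

lemma brunn_minkowski_real:
  fixes A B C :: "real set"
  assumes [measurable]: "A \<in> sets borel" "B \<in> sets borel" "C \<in> sets borel"
    and ne: "A \<noteq> {}" "B \<noteq> {}"
    and sub: "\<And>a b. a \<in> A \<Longrightarrow> b \<in> B \<Longrightarrow> a + b \<in> C"
  shows "emeasure lborel A + emeasure lborel B \<le> emeasure lborel C"
proof -
  obtain a b where ab: "a \<in> A" "b \<in> B" using ne by auto
  \<comment> \<open>Starting the cuts at points of \<open>A\<close> and \<open>B\<close> keeps every
    truncated set nonempty.\<close>
  define A' where "A' k = A \<inter> {..a + real k}" for k
  define B' where "B' k = B \<inter> {b - real k..}" for k
  have [measurable]: "A' k \<in> sets borel" "B' k \<in> sets borel" for k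
    by (auto simp: A'_def B'_def)
  have inc: "incseq A'" "incseq B'" by (auto simp: A'_def B'_def incseq_def)
  have "x \<in> (\<Union>k. A' k)" if "x \<in> A" for x
    using that real_arch_simple[of "x - a"] by (auto simp: A'_def algebra_simps)
  then have UA: "(\<Union>k. A' k) = A" by (auto simp: A'_def)
  have "x \<in> (\<Union>k. B' k)" if "x \<in> B" for x
    using that real_arch_simple[of "b - x"] by (auto simp: B'_def algebra_simps)
  then have UB: "(\<Union>k. B' k) = B" by (auto simp: B'_def)
  have "emeasure lborel A + emeasure lborel B
      = (SUP k. emeasure lborel (A' k)) + (SUP k. emeasure lborel (B' k))"
    using inc by (subst (1 2) SUP_emeasure_incseq) (auto simp: UA UB)
  also have "\<dots> = (SUP k. emeasure lborel (A' k) + emeasure lborel (B' k))"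
    by (intro ennreal_SUP_add[symmetric])
      (auto simp: incseq_def A'_def B'_def intro!: emeasure_mono)
  also have "\<dots> \<le> emeasure lborel C"
  proof (rule SUP_least, rule brunn_minkowski_real_bounded)
    fix k
    show "A' k \<noteq> {}" "B' k \<noteq> {}" using ab by (auto simp: A'_def B'_def)
    show "bdd_above (A' k)" by (rule bdd_aboveI[where M="a + real k"]) (simp add: A'_def)
    show "bdd_below (B' k)" by (rule bdd_belowI[where m="b - real k"]) (simp add: B'_def)
    show "x + y \<in> C" if "x \<in> A' k" "y \<in> B' k" for x y
      using that sub by (auto simp: A'_def B'_def)
  qed auto
  finally show ?thesis .
qed

text \<open>Dilation by \<open>1 - s\<close> and \<open>s\<close> reduces this to the unweighted
  inequality.\<close>

lemma brunn_minkowski_real_convex: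
  fixes A B C :: "real set"
  assumes [measurable]: "A \<in> sets borel" "B \<in> sets borel" "C \<in> sets borel"
    and ne: "A \<noteq> {}" "B \<noteq> {}" and s: "0 < s" "s < 1"
    and sub: "\<And>a b. a \<in> A \<Longrightarrow> b \<in> B \<Longrightarrow> (1 - s) * a + s * b \<in> C"
  shows "ennreal (1 - s) * emeasure lborel A + ennreal s * emeasure lborel B \<le> emeasure lborel C"
proof -
  have scale: "emeasure lborel ((\<lambda>x. x / c) -` S) = ennreal c * emeasure lborel S"
    if [measurable]: "S \<in> sets borel" and c: "c > 0" for S and c :: real
  proof -
    have [measurable]: "(\<lambda>x. x / c) -` S \<in> sets borel"
      by (rule measurable_sets_borel[where M=borel]) auto
    have "emeasure lborel ((\<lambda>x. x / c) -` S) = (\<integral>\<^sup>+x. indicator ((\<lambda>x. x / c) -` S) x \<partial>lborel)"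
      by simp
    also have "\<dots> = \<bar>c\<bar> * (\<integral>\<^sup>+x. indicator ((\<lambda>x. x / c) -` S) (0 + c * x) \<partial>lborel)"
      using c by (intro nn_integral_real_affine) auto
    also have "(\<lambda>x. indicator ((\<lambda>x. x / c) -` S) (0 + c * x)) = (indicator S :: real \<Rightarrow> ennreal)"
      using c by (auto simp: fun_eq_iff indicator_def)
    finally show ?thesis using c by simp
  qed
  have "emeasure lborel ((\<lambda>x. x / (1 - s)) -` A) + emeasure lborel ((\<lambda>x. x / s) -` B)
      \<le> emeasure lborel C"
  proof (rule brunn_minkowski_real)
    show "(\<lambda>x. x / (1 - s)) -` A \<in> sets borel" "(\<lambda>x. x / s) -` B \<in> sets borel"
      by (auto intro!: measurable_sets_borel[where M=borel])
    obtain a b where ab: "a \<in> A" "b \<in> B" using ne by auto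
    have "(1 - s) * a \<in> (\<lambda>x. x / (1 - s)) -` A" "s * b \<in> (\<lambda>x. x / s) -` B"
      using ab s by simp_all
    then show "(\<lambda>x. x / (1 - s)) -` A \<noteq> {}" "(\<lambda>x. x / s) -` B \<noteq> {}"
      by blast+
    show "a + b \<in> C" if "a \<in> (\<lambda>x. x / (1 - s)) -` A" "b \<in> (\<lambda>x. x / s) -` B" for a b
      using sub[of "a / (1 - s)" "b / s"] that s by simp
  qed simp
  then show ?thesis using s by (simp add: scale)
qed

text \<open>The inequality \<open>a\<^sup>1\<^sup>-\<^sup>s b\<^sup>s \<le> c\<close> for extended nonnegative reals, for which there is no
  \<open>powr\<close>. Quantifying over real lower bounds of \<open>a\<close> and \<open>b\<close> gives \<open>0 \<cdot> \<infinity> = 0\<close>, so that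
  the Prekopa-Leindler inequality needs no integrability assumption and passes to marginals.\<close>

definition geo_le :: "real \<Rightarrow> ennreal \<Rightarrow> ennreal \<Rightarrow> ennreal \<Rightarrow> bool" where
  "geo_le s a b c \<longleftrightarrow>
     (\<forall>x\<ge>0. \<forall>y\<ge>0. ennreal x \<le> a \<longrightarrow> ennreal y \<le> b \<longrightarrow> ennreal (x powr (1 - s) * y powr s) \<le> c)"

lemma geo_leI:
  assumes "\<And>x y. 0 < x \<Longrightarrow> 0 < y \<Longrightarrow> ennreal x \<le> a \<Longrightarrow> ennreal y \<le> b
    \<Longrightarrow> ennreal (x powr (1 - s) * y powr s) \<le> c"
  shows "geo_le s a b c"
  unfolding geo_le_def
proof (intro allI impI)
  fix x y :: real assume "0 \<le> x" "0 \<le> y" "ennreal x \<le> a" "ennreal y \<le> b"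
  then show "ennreal (x powr (1 - s) * y powr s) \<le> c"
    using assms[of x y] by (cases "x = 0"; cases "y = 0") simp_all
qed

lemma geo_leD:
  "geo_le s a b c \<Longrightarrow> 0 \<le> x \<Longrightarrow> 0 \<le> y \<Longrightarrow> ennreal x \<le> a \<Longrightarrow> ennreal y \<le> b
    \<Longrightarrow> ennreal (x powr (1 - s) * y powr s) \<le> c"
  by (simp add: geo_le_def)

lemma geo_le_mono: "geo_le s a b c \<Longrightarrow> a' \<le> a \<Longrightarrow> b' \<le> b \<Longrightarrow> geo_le s a' b' c"
  unfolding geo_le_def by (meson order_trans)

lemma weighted_arith_geo_mean:
  fixes x y s :: real
  assumes "0 < x" "0 < y" "0 < s" "s < 1"
  shows "x powr (1 - s) * y powr s \<le> (1 - s) * x + s * y"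
proof -
  have "exp ((1 - s) *\<^sub>R ln x + s *\<^sub>R ln y) \<le> (1 - s) * exp (ln x) + s * exp (ln y)"
    using assms by (intro convex_onD[OF exp_convex]) auto
  then show ?thesis
    using assms by (simp add: powr_def exp_add)
qed

section \<open>Prekopa-Leindler on the real line\<close>

text \<open>Each value \<open>u x\<close> is the length of the set of levels strictly between 0 and
  \<open>u x\<close>; Tonelli's theorem then exchanges the two integrals.\<close>

lemma nn_integral_layer_cake:
  assumes [measurable]: "u \<in> borel_measurable lborel"
  shows "(\<integral>\<^sup>+x. u x \<partial>lborel)
    = (\<integral>\<^sup>+r. indicator {0<..} r * emeasure lborel {x. ennreal r < u x} \<partial>lborel)"
proof -
  have *: "u x = (\<integral>\<^sup>+r. indicator {0<..} r * indicator {x. ennreal r < u x} x \<partial>lborel)" for x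
  proof -
    let ?S = "{r. 0 < r \<and> ennreal r < u x}"
    have "?S \<in> sets borel \<and> emeasure lborel ?S = u x"
    proof (cases "u x")
      case (real c)
      then have "?S = {0<..<c}"
        by (auto simp: ennreal_less_iff)
      then show ?thesis using real by simp
    next
      case top
      then have "?S = {0<..}" by (auto simp: ennreal_less_top)
      moreover have "of_nat k \<le> emeasure lborel {0::real<..}" for k
      proof -
        have "emeasure lborel {0<..<real k} \<le> emeasure lborel {0::real<..}"
          by (rule emeasure_mono) auto
        then show ?thesis by (simp add: ennreal_of_nat_eq_real_of_nat)
      qed
      then have "emeasure lborel {0::real<..} = \<top>"
        using SUP_least[of UNIV "of_nat :: nat \<Rightarrow> ennreal" "emeasure lborel {0::real<..}"]
        by (simp add: ennreal_SUP_of_nat_eq_top top_unique)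
      ultimately show ?thesis using top by simp
    qed
    then have "u x = (\<integral>\<^sup>+r. indicator ?S r \<partial>lborel)" by simp
    also have "\<dots> = (\<integral>\<^sup>+r. indicator {0<..} r * indicator {x. ennreal r < u x} x \<partial>lborel)"
      by (intro nn_integral_cong) (simp add: indicator_def)
    finally show ?thesis .
  qed
  have "(\<integral>\<^sup>+x. u x \<partial>lborel)
      = (\<integral>\<^sup>+x. (\<integral>\<^sup>+r. indicator {0<..} r * indicator {x. ennreal r < u x} x \<partial>lborel) \<partial>lborel)"
    by (rule nn_integral_cong) (rule *)
  also have "\<dots> = (\<integral>\<^sup>+r. (\<integral>\<^sup>+x. indicator {0<..} r * indicator {x. ennreal r < u x} x \<partial>lborel) \<partial>lborel)"
    by (rule lborel_pair.Fubini') measurable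
  also have "\<dots> = (\<integral>\<^sup>+r. indicator {0<..} r * emeasure lborel {x. ennreal r < u x} \<partial>lborel)"
    by (intro nn_integral_cong) (simp add: nn_integral_cmult)
  finally show ?thesis .
qed

text \<open>By \<open>geo\<close>, points of the level sets of \<open>u\<close> and \<open>v\<close>
  at height \<open>r\<close> combine into the level set of \<open>w\<close>, so Brunn-Minkowski
  applies at each height and the layer cake formula integrates the result. Equal suprema make both
  level sets nonempty at the same heights, namely those below 1.\<close>

lemma prekopa_leindler_real_normalized:
  fixes u v w :: "real \<Rightarrow> ennreal"
  assumes [measurable]: "u \<in> borel_measurable borel" "v \<in> borel_measurable borel"
      "w \<in> borel_measurable borel"
    and s: "0 < s" "s < 1"
    and sup: "(SUP x. u x) = 1" "(SUP x. v x) = 1"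
    and geo: "\<And>x y. geo_le s (u x) (v y) (w ((1 - s) * x + s * y))"
  shows "ennreal (1 - s) * (\<integral>\<^sup>+x. u x \<partial>lborel) + ennreal s * (\<integral>\<^sup>+x. v x \<partial>lborel)
    \<le> (\<integral>\<^sup>+x. w x \<partial>lborel)"
proof -
  let ?m = "\<lambda>f r. emeasure lborel {x. ennreal r < f x} :: ennreal"
  have le1: "u x \<le> 1" "v x \<le> 1" for x
    using sup SUP_upper[of x UNIV u] SUP_upper[of x UNIV v] by auto
  have level: "ennreal (1 - s) * ?m u r + ennreal s * ?m v r \<le> ?m w r" if r: "0 < r" for r
  proof (cases "r < 1")
    case True
    have "\<exists>x. ennreal r < u x" "\<exists>x. ennreal r < v x"
      using True r sup less_SUP_iff[of "ennreal r" u UNIV] less_SUP_iff[of "ennreal r" v UNIV]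
      by (auto simp: ennreal_less_one_iff)
    then show ?thesis
    proof (intro brunn_minkowski_real_convex s)
      fix a b assume "a \<in> {x. ennreal r < u x}" "b \<in> {x. ennreal r < v x}"
      \<comment> \<open>The values \<open>u a\<close> and \<open>v b\<close> may be infinite; real
        numbers strictly between \<open>r\<close> and them can be fed to \<open>geo_le\<close> and
        keep the conclusion strict.\<close>
      then obtain a' b' where a': "ennreal r < a'" "a' < u a" and b': "ennreal r < b'" "b' < v b"
        using dense by (metis mem_Collect_eq)
      from a' obtain a'' where a'': "a' = ennreal a''" "0 \<le> a''" by (cases a') auto
      from b' obtain b'' where b'': "b' = ennreal b''" "0 \<le> b''" by (cases b') auto
      have rr: "r < a''" "r < b''"
        using a' b' a'' b'' r by (auto simp: ennreal_less_iff)
      have "r = r powr (1 - s) * r powr s" using r by (simp flip: powr_add)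
      also have "\<dots> < a'' powr (1 - s) * b'' powr s"
        using rr r s by (intro mult_strict_mono powr_less_mono2) auto
      finally have "ennreal r < ennreal (a'' powr (1 - s) * b'' powr s)"
        using r by (simp add: ennreal_less_iff)
      also have "\<dots> \<le> w ((1 - s) * a + s * b)"
        using geo_leD[OF geo, of a'' b'' a b] a' b' a'' b'' by auto
      finally show "(1 - s) * a + s * b \<in> {x. ennreal r < w x}" by simp
    qed auto
  next
    case False
    then have "{x. ennreal r < u x} = {}" "{x. ennreal r < v x} = {}"
      using le1 by (auto simp: not_less) (metis ennreal_1 ennreal_leI order_trans)+
    then show ?thesis by (simp only: emeasure_empty) simp
  qed
  have [measurable]: "(\<lambda>r. indicator {0<..} r * ?m f r) \<in> borel_measurable borel"
    if [measurable]: "f \<in> borel_measurable borel" for f :: "real \<Rightarrow> ennreal"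
    by measurable
  have "ennreal (1 - s) * (\<integral>\<^sup>+x. u x \<partial>lborel) + ennreal s * (\<integral>\<^sup>+x. v x \<partial>lborel)
     = (\<integral>\<^sup>+r. ennreal (1 - s) * (indicator {0<..} r * ?m u r)
           + ennreal s * (indicator {0<..} r * ?m v r) \<partial>lborel)"
    by (simp add: nn_integral_layer_cake[of u] nn_integral_layer_cake[of v]
        nn_integral_add nn_integral_cmult)
  also have "\<dots> \<le> (\<integral>\<^sup>+r. indicator {0<..} r * ?m w r \<partial>lborel)"
    using level by (intro nn_integral_mono) (simp add: indicator_def)
  also have "\<dots> = (\<integral>\<^sup>+x. w x \<partial>lborel)"
    by (simp add: nn_integral_layer_cake[of w])
  finally show ?thesis .
qed

text \<open>Dividing \<open>u\<close> and \<open>v\<close> by their suprema reaches the normalized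
  case. The weighted arithmetic-geometric mean inequality weakens its conclusion to the geometric
  mean, which is homogeneous and so lets the scaling be undone.\<close>

lemma prekopa_leindler_real_bounded:
  fixes u v w :: "real \<Rightarrow> ennreal"
  assumes [measurable]: "u \<in> borel_measurable borel" "v \<in> borel_measurable borel"
      "w \<in> borel_measurable borel"
    and s: "0 < s" "s < 1"
    and bdd: "\<And>x. u x \<le> ennreal K" "\<And>x. v x \<le> ennreal K"
    and geo: "\<And>x y. geo_le s (u x) (v y) (w ((1 - s) * x + s * y))"
  shows "geo_le s (\<integral>\<^sup>+x. u x \<partial>lborel) (\<integral>\<^sup>+x. v x \<partial>lborel) (\<integral>\<^sup>+x. w x \<partial>lborel)"
proof (rule geo_leI)
  fix a b :: real
  assume a: "0 < a" "ennreal a \<le> (\<integral>\<^sup>+x. u x \<partial>lborel)"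
    and b: "0 < b" "ennreal b \<le> (\<integral>\<^sup>+x. v x \<partial>lborel)"
  \<comment> \<open>The bound \<open>K\<close> makes the supremum finite and a positive integral
    makes it nonzero, so it can be divided out.\<close>
  have norm: "\<exists>m>0. (SUP x. f x / ennreal m) = 1"
    if f: "\<And>x. f x \<le> ennreal K" and c: "0 < c" "ennreal c \<le> (\<integral>\<^sup>+x. f x \<partial>lborel)"
    for f :: "real \<Rightarrow> ennreal" and c
  proof -
    have "(SUP x. f x) \<le> ennreal K" using f by (auto intro: SUP_least)
    then obtain m where m: "(SUP x. f x) = ennreal m" "0 \<le> m"
      by (cases "SUP x. f x") (auto simp: top_unique)
    have "m \<noteq> 0"
    proof
      assume "m = 0"
      then have "f x = 0" for x using m SUP_upper[of x UNIV f] by auto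
      then show False using c by simp
    qed
    then have "(SUP x. f x / ennreal m) = 1"
      using m by (simp flip: SUP_divide_ennreal add: ennreal_divide_self)
    then show ?thesis using \<open>m \<noteq> 0\<close> \<open>0 \<le> m\<close> by (intro exI[of _ m]) auto
  qed
  obtain p where p: "0 < p" "(SUP x. u x / ennreal p) = 1" using norm[OF bdd(1) a] by blast
  obtain q where q: "0 < q" "(SUP x. v x / ennreal q) = 1" using norm[OF bdd(2) b] by blast
  define r where "r = p powr (1 - s) * q powr s"
  have r: "0 < r" using p q by (simp add: r_def)
  have div_le: "ennreal x \<le> t / ennreal c \<longleftrightarrow> ennreal (x * c) \<le> t" if "0 \<le> x" "0 < c" for x c t
    using that
    by (cases t) (simp_all add: divide_ennreal ennreal_le_iff pos_le_divide_eq ennreal_top_divide)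
  have "ennreal (1 - s) * (\<integral>\<^sup>+x. u x / ennreal p \<partial>lborel) + ennreal s * (\<integral>\<^sup>+x. v x / ennreal q \<partial>lborel)
    \<le> (\<integral>\<^sup>+x. w x / ennreal r \<partial>lborel)"
  proof (rule prekopa_leindler_real_normalized[OF _ _ _ s p(2) q(2)])
    fix x y
    show "geo_le s (u x / ennreal p) (v y / ennreal q) (w ((1 - s) * x + s * y) / ennreal r)"
    proof (rule geo_leI)
      fix x' y' :: real
      assume *: "0 < x'" "0 < y'" "ennreal x' \<le> u x / ennreal p" "ennreal y' \<le> v y / ennreal q"
      then have "ennreal ((x' * p) powr (1 - s) * (y' * q) powr s) \<le> w ((1 - s) * x + s * y)"
        using p q by (intro geo_leD[OF geo]) (auto simp: div_le)
      then show "ennreal (x' powr (1 - s) * y' powr s) \<le> w ((1 - s) * x + s * y) / ennreal r"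
        using * p q r by (simp add: div_le r_def powr_mult ac_simps)
    qed
  qed auto
  then have "ennreal (1 - s) * ((\<integral>\<^sup>+x. u x \<partial>lborel) / ennreal p) + ennreal s * ((\<integral>\<^sup>+x. v x \<partial>lborel) / ennreal q)
    \<le> (\<integral>\<^sup>+x. w x \<partial>lborel) / ennreal r"
    by (simp add: nn_integral_divide)
  moreover have "ennreal (a / p) \<le> (\<integral>\<^sup>+x. u x \<partial>lborel) / ennreal p"
    "ennreal (b / q) \<le> (\<integral>\<^sup>+x. v x \<partial>lborel) / ennreal q"
    using a b p q by (simp_all add: div_le)
  ultimately have "ennreal (1 - s) * ennreal (a / p) + ennreal s * ennreal (b / q)
    \<le> (\<integral>\<^sup>+x. w x \<partial>lborel) / ennreal r"
    by (meson add_mono mult_left_mono order_trans zero_le)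
  then have "ennreal ((1 - s) * (a / p) + s * (b / q)) \<le> (\<integral>\<^sup>+x. w x \<partial>lborel) / ennreal r"
    using a b p q s
    by (simp add: ennreal_plus ennreal_mult del: times_divide_eq_right)
  moreover have "(a / p) powr (1 - s) * (b / q) powr s \<le> (1 - s) * (a / p) + s * (b / q)"
    using a b p q s by (intro weighted_arith_geo_mean) auto
  ultimately have "ennreal ((a / p) powr (1 - s) * (b / q) powr s) \<le> (\<integral>\<^sup>+x. w x \<partial>lborel) / ennreal r"
    by (meson ennreal_leI order_trans)
  then show "ennreal (a powr (1 - s) * b powr s) \<le> (\<integral>\<^sup>+x. w x \<partial>lborel)"
    using a b p q r by (simp add: div_le r_def powr_divide)
qed

text \<open>A number at most the supremum need not be at most any term, so \<open>x\<close> and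
  \<open>y\<close> are first shrunk by a factor \<open>e < 1\<close>. The exponents sum to one,
  hence the product shrinks by exactly \<open>e\<close>, and \<open>e\<close> tends to 1.\<close>

lemma geo_le_SUP:
  fixes a b :: "nat \<Rightarrow> ennreal"
  assumes s: "0 < s" "s < 1" and inc: "incseq a" "incseq b"
    and geo: "\<And>k. geo_le s (a k) (b k) c"
  shows "geo_le s (SUP k. a k) (SUP k. b k) c"
proof (rule geo_leI)
  fix x y :: real
  assume x: "0 < x" "ennreal x \<le> (SUP k. a k)" and y: "0 < y" "ennreal y \<le> (SUP k. b k)"
  have step: "ennreal ((e * x) powr (1 - s) * (e * y) powr s) \<le> c" if e: "0 < e" "e < 1" for e
  proof -
    have "ennreal (e * x) < ennreal x" "ennreal (e * y) < ennreal y"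
      using e x y by (auto simp: ennreal_less_iff)
    then obtain i j where ij: "ennreal (e * x) < a i" "ennreal (e * y) < b j"
      using x y by (meson less_SUP_iff less_le_trans)
    show ?thesis
    proof (rule geo_leD[OF geo[of "max i j"]])
      show "ennreal (e * x) \<le> a (max i j)"
        using ij(1) incseqD[OF inc(1), of i "max i j"] by auto
      show "ennreal (e * y) \<le> b (max i j)"
        using ij(2) incseqD[OF inc(2), of j "max i j"] by auto
    qed (use e x y in auto)
  qed
  have eq: "(e * x) powr (1 - s) * (e * y) powr s = e * (x powr (1 - s) * y powr s)" if "0 < e" for e
  proof -
    have "e powr (1 - s) * e powr s = e" using that by (simp flip: powr_add)
    then have "(e powr (1 - s) * e powr s) * (x powr (1 - s) * y powr s) = e * (x powr (1 - s) * y powr s)"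
      by simp
    then show ?thesis using that x y by (simp add: powr_mult ac_simps)
  qed
  show "ennreal (x powr (1 - s) * y powr s) \<le> c"
  proof (cases c)
    case (real c')
    have "e * (x powr (1 - s) * y powr s) \<le> c'" if "0 < e" "e < 1" for e
      using step[OF that] eq[OF that(1)] real by (simp add: ennreal_le_iff)
    then have "x powr (1 - s) * y powr s \<le> c'"
      by (rule field_le_mult_one_interval)
    then show ?thesis using real by (simp add: ennreal_leI)
  qed simp
qed

text \<open>Truncating \<open>u\<close> and \<open>v\<close> at height \<open>k\<close> preserves
  the pointwise hypothesis with the same \<open>w\<close>, and monotone convergence restores the
  full integrals.\<close>

theorem prekopa_leindler_real:
  fixes u v w :: "real \<Rightarrow> ennreal"
  assumes [measurable]: "u \<in> borel_measurable borel" "v \<in> borel_measurable borel"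
      "w \<in> borel_measurable borel"
    and s: "0 < s" "s < 1"
    and geo: "\<And>x y. geo_le s (u x) (v y) (w ((1 - s) * x + s * y))"
  shows "geo_le s (\<integral>\<^sup>+x. u x \<partial>lborel) (\<integral>\<^sup>+x. v x \<partial>lborel) (\<integral>\<^sup>+x. w x \<partial>lborel)"
proof -
  have trunc: "(\<integral>\<^sup>+x. f x \<partial>lborel) = (SUP k. \<integral>\<^sup>+x. min (f x) (of_nat k) \<partial>lborel)"
    if [measurable]: "f \<in> borel_measurable borel" for f :: "real \<Rightarrow> ennreal"
  proof -
    have "(SUP k. min (f x) (of_nat k)) = f x" for x
    proof -
      have "(SUP k. min (f x) (of_nat k :: ennreal)) = min (f x) (SUP k. of_nat k)"
        by (simp add: inf_SUP flip: inf_min)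
      then show ?thesis by (simp add: ennreal_SUP_of_nat_eq_top min_def)
    qed
    moreover have "incseq (\<lambda>k x. min (f x) (of_nat k))"
      by (auto simp: incseq_def le_fun_def min_le_iff_disj min.coboundedI2)
    ultimately show ?thesis
      by (subst nn_integral_monotone_convergence_SUP[symmetric]) auto
  qed
  have inc: "incseq (\<lambda>k. \<integral>\<^sup>+x. min (f x) (of_nat k) \<partial>lborel)" for f :: "real \<Rightarrow> ennreal"
    by (auto simp: incseq_def min.coboundedI2 intro!: nn_integral_mono)
  have "geo_le s (SUP k. \<integral>\<^sup>+x. min (u x) (of_nat k) \<partial>lborel)
      (SUP k. \<integral>\<^sup>+x. min (v x) (of_nat k) \<partial>lborel) (\<integral>\<^sup>+x. w x \<partial>lborel)"
  proof (intro geo_le_SUP s inc prekopa_leindler_real_bounded)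
    fix k x y
    show "min (u x) (of_nat k) \<le> ennreal (real k)" "min (v x) (of_nat k) \<le> ennreal (real k)"
      by (simp_all add: ennreal_of_nat_eq_real_of_nat)
    show "geo_le s (min (u x) (of_nat k)) (min (v y) (of_nat k)) (w ((1 - s) * x + s * y))"
      by (rule geo_le_mono[OF geo]) auto
  qed auto
  then show ?thesis by (simp flip: trunc)
qed

section \<open>Prekopa-Leindler in several dimensions\<close>

text \<open>Induction on the coordinates. With coordinate \<open>i\<close> fixed at
  \<open>a\<close>, \<open>b\<close> and their combination, the induction hypothesis compares the
  integrals over the rest; this is the pointwise hypothesis of the one-dimensional inequality for
  the marginals.\<close>

theorem prekopa_leindler_PiM:
  fixes u v w :: "('i \<Rightarrow> real) \<Rightarrow> ennreal"
  assumes "finite I" and s: "0 < s" "s < 1"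
    and "u \<in> borel_measurable (Pi\<^sub>M I (\<lambda>_. lborel))" "v \<in> borel_measurable (Pi\<^sub>M I (\<lambda>_. lborel))"
      "w \<in> borel_measurable (Pi\<^sub>M I (\<lambda>_. lborel))"
    and "\<And>x y. x \<in> extensional I \<Longrightarrow> y \<in> extensional I \<Longrightarrow>
      geo_le s (u x) (v y) (w (\<lambda>i\<in>I. (1 - s) * x i + s * y i))"
  shows "geo_le s (\<integral>\<^sup>+x. u x \<partial>Pi\<^sub>M I (\<lambda>_. lborel)) (\<integral>\<^sup>+x. v x \<partial>Pi\<^sub>M I (\<lambda>_. lborel))
    (\<integral>\<^sup>+x. w x \<partial>Pi\<^sub>M I (\<lambda>_. lborel))"
  using assms(1,4-)
proof (induction I arbitrary: u v w rule: finite_induct)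
  case empty
  interpret product_sigma_finite "\<lambda>_::'i. lborel :: real measure" ..
  \<comment> \<open>The empty product carries unit mass on the single function that is
    \<open>undefined\<close> everywhere.\<close>
  show ?case
    using empty(4)[of "\<lambda>_. undefined" "\<lambda>_. undefined"]
    by (simp add: PiM_empty nn_integral_count_space_finite extensional_def restrict_def)
next
  case (insert i I)
  interpret product_sigma_finite "\<lambda>_::'i. lborel :: real measure" ..
  let ?P = "Pi\<^sub>M I (\<lambda>_. lborel :: real measure)"
  note [measurable] = insert.prems(1-3)
  have upd: "(\<lambda>(y, x). x(i := y)) \<in> measurable (lborel \<Otimes>\<^sub>M ?P) (Pi\<^sub>M (insert i I) (\<lambda>_. lborel))"
    unfolding split_beta' by (rule measurable_fun_upd[where J=I]) auto
  have sect: "(\<lambda>x. f (x(i := y))) \<in> borel_measurable ?P"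
    and marg: "(\<lambda>y. \<integral>\<^sup>+x. f (x(i := y)) \<partial>?P) \<in> borel_measurable borel"
    if "f \<in> borel_measurable (Pi\<^sub>M (insert i I) (\<lambda>_. lborel))"
    for f :: "('i \<Rightarrow> real) \<Rightarrow> ennreal" and y
  proof -
    have m: "(\<lambda>(y, x). f (x(i := y))) \<in> borel_measurable (lborel \<Otimes>\<^sub>M ?P)"
      using measurable_compose[OF upd that] by (simp add: split_beta')
    show "(\<lambda>x. f (x(i := y))) \<in> borel_measurable ?P"
      using measurable_Pair2[OF m, of y] by simp
    interpret sigma_finite_measure ?P
      by (rule sigma_finite[OF insert.hyps(1)])
    show "(\<lambda>y. \<integral>\<^sup>+x. f (x(i := y)) \<partial>?P) \<in> borel_measurable borel"
      using borel_measurable_nn_integral[OF m] by simp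
  qed
  have "geo_le s (\<integral>\<^sup>+y. \<integral>\<^sup>+x. u (x(i := y)) \<partial>?P \<partial>lborel) (\<integral>\<^sup>+y. \<integral>\<^sup>+x. v (x(i := y)) \<partial>?P \<partial>lborel)
     (\<integral>\<^sup>+y. \<integral>\<^sup>+x. w (x(i := y)) \<partial>?P \<partial>lborel)"
  proof (intro prekopa_leindler_real s)
    fix a b
    show "geo_le s (\<integral>\<^sup>+x. u (x(i := a)) \<partial>?P) (\<integral>\<^sup>+x. v (x(i := b)) \<partial>?P)
       (\<integral>\<^sup>+x. w (x(i := (1 - s) * a + s * b)) \<partial>?P)"
    proof (rule insert.IH)
      fix x y :: "'i \<Rightarrow> real" assume "x \<in> extensional I" "y \<in> extensional I"
      then have "geo_le s (u (x(i := a))) (v (y(i := b)))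
          (w (\<lambda>j\<in>insert i I. (1 - s) * (x(i := a)) j + s * (y(i := b)) j))"
        by (intro insert.prems) (auto simp: extensional_def)
      also have "(\<lambda>j\<in>insert i I. (1 - s) * (x(i := a)) j + s * (y(i := b)) j)
          = (\<lambda>j\<in>I. (1 - s) * x j + s * y j)(i := (1 - s) * a + s * b)"
        by (auto simp: fun_eq_iff restrict_def)
      finally show "geo_le s (u (x(i := a))) (v (y(i := b)))
          (w ((\<lambda>j\<in>I. (1 - s) * x j + s * y j)(i := (1 - s) * a + s * b)))" .
    qed (rule sect insert.prems(1-3))+
  qed (rule marg insert.prems(1-3))+
  then show ?case
    using insert.hyps by (simp add: product_nn_integral_insert_rev)
qed

text \<open>Lebesgue measure is the image of the product measure under expansion in
  \<open>Basis\<close>, and this map commutes with convex combinations.\<close>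

theorem prekopa_leindler:
  fixes u v w :: "'a::euclidean_space \<Rightarrow> ennreal"
  assumes [measurable]: "u \<in> borel_measurable borel" "v \<in> borel_measurable borel"
      "w \<in> borel_measurable borel"
    and s: "0 < s" "s < 1"
    and geo: "\<And>x y. geo_le s (u x) (v y) (w ((1 - s) *\<^sub>R x + s *\<^sub>R y))"
  shows "geo_le s (\<integral>\<^sup>+x. u x \<partial>lborel) (\<integral>\<^sup>+x. v x \<partial>lborel) (\<integral>\<^sup>+x. w x \<partial>lborel)"
proof -
  let ?e = "\<lambda>f :: 'a \<Rightarrow> real. \<Sum>b\<in>Basis. f b *\<^sub>R b"
  let ?P = "Pi\<^sub>M (Basis :: 'a set) (\<lambda>_. lborel :: real measure)"
  have [measurable]: "?e \<in> measurable ?P borel" by measurable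
  have eq: "(\<integral>\<^sup>+x. f x \<partial>lborel) = (\<integral>\<^sup>+x. f (?e x) \<partial>?P)"
    if [measurable]: "f \<in> borel_measurable borel" for f :: "'a \<Rightarrow> ennreal"
    by (subst lborel_eq) (simp add: nn_integral_distr)
  have "geo_le s (\<integral>\<^sup>+x. u (?e x) \<partial>?P) (\<integral>\<^sup>+x. v (?e x) \<partial>?P) (\<integral>\<^sup>+x. w (?e x) \<partial>?P)"
  proof (rule prekopa_leindler_PiM)
    fix x y :: "'a \<Rightarrow> real"
    have "?e (\<lambda>i\<in>Basis. (1 - s) * x i + s * y i) = (1 - s) *\<^sub>R ?e x + s *\<^sub>R ?e y"
      by (simp add: scaleR_sum_right scaleR_add_left sum.distrib)
    then show "geo_le s (u (?e x)) (v (?e y)) (w (?e (\<lambda>i\<in>Basis. (1 - s) * x i + s * y i)))"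
      using geo by simp
  qed (use s in auto)
  then show ?thesis by (simp add: eq)
qed

subsection \<open>Gaussian concentration for Lipschitz functions\<close>

lemma geo_le_ennreal:
  assumes "0 \<le> a" "0 \<le> b" "0 < s" "s < 1" "a powr (1 - s) * b powr s \<le> c"
  shows "geo_le s (ennreal a) (ennreal b) (ennreal c)"
proof (rule geo_leI)
  fix x y :: real assume "0 < x" "0 < y" "ennreal x \<le> ennreal a" "ennreal y \<le> ennreal b"
  then have "x \<le> a" "y \<le> b" using assms by (auto simp: ennreal_le_iff)
  then have "x powr (1 - s) * y powr s \<le> a powr (1 - s) * b powr s"
    using assms \<open>0 < x\<close> \<open>0 < y\<close> by (intro mult_mono powr_mono2) auto
  then show "ennreal (x powr (1 - s) * y powr s) \<le> ennreal c"
    using assms by (intro ennreal_leI) linarith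
qed

text \<open>Strong convexity of the squared norm as an identity: the last term is the quadratic
  reserve that later absorbs the Lipschitz increment of \<open>F\<close>.\<close>

lemma norm_sq_convex_combination:
  fixes x y :: "'a::real_inner"
  shows "(norm ((1 - s) *\<^sub>R x + s *\<^sub>R y))\<^sup>2
    = (1 - s) * (norm x)\<^sup>2 + s * (norm y)\<^sup>2 - s * (1 - s) * (norm (x - y))\<^sup>2"
  unfolding power2_norm_eq_inner
  by (simp add: inner_simps inner_commute algebra_simps power2_eq_square)

text \<open>The logarithm of the normalizing constant is kept as a parameter \<open>z\<close>: its value plays no
  role once the density is known to have mass one.\<close>

definition gauss :: "real \<Rightarrow> real \<Rightarrow> 'a::euclidean_space \<Rightarrow> real" where
  "gauss \<sigma> z x = exp (- (norm x)\<^sup>2 / (2 * \<sigma>\<^sup>2) - z)"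

lemma borel_measurable_gauss [measurable]: "gauss \<sigma> z \<in> borel_measurable borel"
  unfolding gauss_def by measurable

lemma gauss_nonneg [simp]: "0 \<le> gauss \<sigma> z x"
  by (simp add: gauss_def)

lemma lipschitz_borel_measurable:
  fixes F :: "'a::real_normed_vector \<Rightarrow> real"
  assumes L: "0 \<le> L" and lip: "\<And>x y. F x - F y \<le> L * norm (x - y)"
  shows "F \<in> borel_measurable borel"
proof (rule borel_measurable_continuous_onI)
  have "\<bar>F x - F y\<bar> \<le> L * norm (x - y)" for x y
    using lip[of x y] lip[of y x] by (simp add: abs_le_iff norm_minus_commute)
  then have "L-lipschitz_on UNIV F"
    using L by (intro lipschitz_onI) (auto simp: dist_norm)
  then show "continuous_on UNIV F" by (rule lipschitz_on_continuous_on)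
qed

section \<open>Integrability, exponential moments and tails under a Gaussian law\<close>

context
  fixes \<sigma> z :: real and G :: "'a::euclidean_space measure" and F :: "'a \<Rightarrow> real" and L :: real
  defines "G \<equiv> density lborel (\<lambda>x. ennreal (gauss \<sigma> z x))"
  assumes \<sigma>: "0 < \<sigma>" and G: "prob_space G"
    and L: "0 \<le> L" and lip: "\<And>x y. F x - F y \<le> L * norm (x - y)"
begin

lemma nn_integral_gauss: "(\<integral>\<^sup>+x. ennreal (gauss \<sigma> z x) \<partial>(lborel :: 'a measure)) = 1"
  using prob_space.emeasure_space_1[OF G] by (simp add: G_def emeasure_density)

text \<open>\<open>F\<close> grows at most linearly, and \<open>norm x\<close> times the density is
  at most \<open>\<sigma>\<close> times a Gaussian shape of doubled variance, which has finite mass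
  by scaling.\<close>

lemma lipschitz_integrable: "integrable G F"
proof -
  note [measurable] = lipschitz_borel_measurable[OF L lip]
  interpret prob_space G by (rule G)
  have bound: "norm x * gauss \<sigma> z x \<le> \<sigma> * exp (- (norm x)\<^sup>2 / (4 * \<sigma>\<^sup>2) - z)" for x :: 'a
  proof -
    have "0 \<le> (norm x / (2 * \<sigma>) - 1)\<^sup>2" by simp
    then have "norm x / \<sigma> \<le> 1 + (norm x)\<^sup>2 / (4 * \<sigma>\<^sup>2)"
      using \<sigma> by (simp add: power2_diff power_divide power_mult_distrib)
    also have "\<dots> \<le> exp ((norm x)\<^sup>2 / (4 * \<sigma>\<^sup>2))" by (rule exp_ge_add_one_self)
    finally have "norm x \<le> \<sigma> * exp ((norm x)\<^sup>2 / (4 * \<sigma>\<^sup>2))"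
      using \<sigma> by (simp add: pos_divide_le_eq mult.commute)
    then have "norm x * gauss \<sigma> z x \<le> \<sigma> * exp ((norm x)\<^sup>2 / (4 * \<sigma>\<^sup>2)) * gauss \<sigma> z x"
      by (intro mult_right_mono) auto
    also have "\<dots> = \<sigma> * exp (- (norm x)\<^sup>2 / (4 * \<sigma>\<^sup>2) - z)"
      using \<sigma> by (simp add: gauss_def exp_add[symmetric] mult.assoc)
    finally show ?thesis .
  qed
  have "(\<integral>\<^sup>+x. ennreal (norm x) \<partial>G) = (\<integral>\<^sup>+x. ennreal (norm x * gauss \<sigma> z x) \<partial>(lborel :: 'a measure))"
    by (simp add: G_def nn_integral_density ennreal_mult' mult.commute)
  also have "\<dots> \<le> (\<integral>\<^sup>+x. ennreal (\<sigma> * exp (- (norm x)\<^sup>2 / (4 * \<sigma>\<^sup>2) - z)) \<partial>(lborel :: 'a measure))"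
    by (intro nn_integral_mono ennreal_leI bound)
  also have "\<dots> = ennreal \<sigma> * (\<integral>\<^sup>+x. ennreal (exp (- (norm x)\<^sup>2 / (4 * \<sigma>\<^sup>2) - z)) \<partial>(lborel :: 'a measure))"
    using \<sigma> by (simp add: ennreal_mult' nn_integral_cmult)
  also have "(\<integral>\<^sup>+x. ennreal (exp (- (norm x)\<^sup>2 / (4 * \<sigma>\<^sup>2) - z)) \<partial>(lborel :: 'a measure))
      = ennreal (sqrt 2 ^ DIM('a)) * (\<integral>\<^sup>+x. ennreal (gauss \<sigma> z x) \<partial>(lborel :: 'a measure))"
    \<comment> \<open>Substitution with the factor \<open>sqrt 2\<close> turns the shape of doubled
      variance back into \<open>gauss\<close>; the power of \<open>sqrt 2\<close> is the
      Jacobian.\<close>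
    by (subst lborel_affine[of "sqrt 2" 0])
      (simp_all add: nn_integral_density nn_integral_distr nn_integral_cmult gauss_def
        power_mult_distrib ennreal_power)
  finally have "(\<integral>\<^sup>+x. ennreal (norm x) \<partial>G) < \<infinity>"
    using \<sigma> by (simp add: nn_integral_gauss ennreal_mult_less_top le_less_trans)
  then have "integrable G (\<lambda>x. norm x)"
    by (intro integrableI_nonneg) (auto simp: G_def)
  then have "integrable G (\<lambda>x. \<bar>F 0\<bar> + L * norm x)"
    by simp
  then show ?thesis
  proof (rule Bochner_Integration.integrable_bound)
    have "\<bar>F x\<bar> \<le> \<bar>F 0\<bar> + L * norm x" for x
      using lip[of x 0] lip[of 0 x] by auto
    then show "AE x in G. norm (F x) \<le> norm (\<bar>F 0\<bar> + L * norm x)"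
      by (intro AE_I2) (simp add: order_trans[OF _ abs_ge_self])
  qed (simp add: G_def)
qed

lemma exp_moment_lipschitz_aux:
  assumes l: "0 \<le> l" and s: "0 < s" "s < 1"
  shows "(\<integral>\<^sup>+x. ennreal (exp (l * (F x - (\<integral>y. F y \<partial>G)))) \<partial>G)
    \<le> ennreal (exp ((l * L * \<sigma>)\<^sup>2 / 2 / (1 - s)))"
proof -
  note [measurable] = lipschitz_borel_measurable[OF L lip]
  interpret prob_space G by (rule G)
  define m where "m = (\<integral>y. F y \<partial>G)"
  txt \<open>With this \<open>c\<close>, the weights \<open>1 - s\<close> and \<open>s\<close> cancel \<open>m\<close> in the pointwise hypothesis of
    Prekopa-Leindler; \<open>k\<close> is the maximum over \<open>d\<close> of \<open>l * L * d - (1 - s) * d\<^sup>2 / (2 * \<sigma>\<^sup>2)\<close>.\<close>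
  define c where "c = s * l / (1 - s)"
  define k where "k = (l * L * \<sigma>)\<^sup>2 / 2 / (1 - s)"
  define u where "u x = ennreal (exp (- c * (F x - m)) * gauss \<sigma> z x)" for x
  define v where "v x = ennreal (exp (l * (F x - m) - k) * gauss \<sigma> z x)" for x
  have [measurable]: "u \<in> borel_measurable borel" "v \<in> borel_measurable borel"
    unfolding u_def[abs_def] v_def[abs_def] by measurable
  have "geo_le s (\<integral>\<^sup>+x. u x \<partial>lborel) (\<integral>\<^sup>+x. v x \<partial>lborel)
      (\<integral>\<^sup>+x. ennreal (gauss \<sigma> z x) \<partial>(lborel :: 'a measure))"
  proof (rule prekopa_leindler[OF _ _ _ s])
    fix x y :: 'a
    define d where "d = norm (x - y)"
    have "F y - F x \<le> L * d" using lip[of y x] by (simp add: d_def norm_minus_commute)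
    then have "l * (F y - F x) \<le> l * (L * d)" using l by (intro mult_left_mono)
    also have "l * (L * d) \<le> k + (1 - s) * d\<^sup>2 / (2 * \<sigma>\<^sup>2)"
    proof -
      \<comment> \<open>The difference is a completed square, zero at
        \<open>d = l * L * \<sigma>\<^sup>2 / (1 - s)\<close>.\<close>
      have "k + (1 - s) * d\<^sup>2 / (2 * \<sigma>\<^sup>2) - l * (L * d)
          = (l * L * \<sigma>\<^sup>2 - (1 - s) * d)\<^sup>2 / (2 * (1 - s) * \<sigma>\<^sup>2)"
        using \<sigma> s unfolding k_def by (simp add: field_simps power2_eq_square)
      moreover have "0 \<le> (l * L * \<sigma>\<^sup>2 - (1 - s) * d)\<^sup>2 / (2 * (1 - s) * \<sigma>\<^sup>2)"
        using s by simp
      ultimately show ?thesis by linarith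
    qed
    finally have "s * (l * (F y - F x)) \<le> s * (k + (1 - s) * d\<^sup>2 / (2 * \<sigma>\<^sup>2))"
      using s by (intro mult_left_mono) auto
    then have 1: "s * l * (F y - m) - s * l * (F x - m) \<le> s * k + s * (1 - s) * (d\<^sup>2 / (2 * \<sigma>\<^sup>2))"
      by (simp add: algebra_simps)
    have 2: "(1 - s) * (- c * (F x - m)) = - (s * l * (F x - m))" using s by (simp add: c_def)
    have 3: "(norm ((1 - s) *\<^sub>R x + s *\<^sub>R y))\<^sup>2 / (2 * \<sigma>\<^sup>2) = (1 - s) * ((norm x)\<^sup>2 / (2 * \<sigma>\<^sup>2))
        + s * ((norm y)\<^sup>2 / (2 * \<sigma>\<^sup>2)) - s * (1 - s) * (d\<^sup>2 / (2 * \<sigma>\<^sup>2))"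
      by (simp add: norm_sq_convex_combination d_def add_divide_distrib diff_divide_distrib)
    have 4: "(1 - s) * (P + (- A - z)) + s * (Q - k + (- B - z))
        = (1 - s) * P + s * Q - s * k - ((1 - s) * A + s * B) - z" for P Q A B
      by (simp add: algebra_simps)
    \<comment> \<open>The pointwise hypothesis in logarithmic form: the term in
      \<open>d\<^sup>2\<close> gained in \<open>3\<close> covers the one spent in
      \<open>1\<close>.\<close>
    have ineq: "(1 - s) * (- c * (F x - m) + (- (norm x)\<^sup>2 / (2 * \<sigma>\<^sup>2) - z))
        + s * (l * (F y - m) - k + (- (norm y)\<^sup>2 / (2 * \<sigma>\<^sup>2) - z))
        \<le> - (norm ((1 - s) *\<^sub>R x + s *\<^sub>R y))\<^sup>2 / (2 * \<sigma>\<^sup>2) - z"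
      using 1 unfolding minus_divide_left[symmetric] 3 4 2 by (simp only: mult.assoc)
    show "geo_le s (u x) (v y) (ennreal (gauss \<sigma> z ((1 - s) *\<^sub>R x + s *\<^sub>R y)))"
      unfolding u_def v_def
    proof (rule geo_le_ennreal[OF _ _ s])
      show "(exp (- c * (F x - m)) * gauss \<sigma> z x) powr (1 - s) *
          (exp (l * (F y - m) - k) * gauss \<sigma> z y) powr s
          \<le> gauss \<sigma> z ((1 - s) *\<^sub>R x + s *\<^sub>R y)"
        using ineq unfolding gauss_def exp_add[symmetric] powr_def by (simp add: mult_exp_exp)
    qed simp_all
  qed simp_all
  then have geo: "geo_le s (\<integral>\<^sup>+x. u x \<partial>lborel) (\<integral>\<^sup>+x. v x \<partial>lborel) 1"
    by (simp add: nn_integral_gauss)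
  \<comment> \<open>Jensen for the exponential through its tangent at 0:
    \<open>1 - c * (F x - m)\<close> has mean 1 and stays below
    \<open>exp (- c * (F x - m))\<close>. The maximum with 0 allows the passage to nonnegative
    integrals.\<close>
  have int: "integrable G (\<lambda>x. 1 - c * (F x - m))"
    using lipschitz_integrable by simp
  have "1 = (\<integral>x. 1 - c * (F x - m) \<partial>G)"
    using lipschitz_integrable prob_space by (simp add: m_def)
  also have "\<dots> \<le> (\<integral>x. max 0 (1 - c * (F x - m)) \<partial>G)"
    by (intro integral_mono int Bochner_Integration.integrable_max integrable_zero) auto
  finally have "1 \<le> ennreal (\<integral>x. max 0 (1 - c * (F x - m)) \<partial>G)"
    by (simp flip: ennreal_1 add: ennreal_le_iff2)
  also have "\<dots> = (\<integral>\<^sup>+x. ennreal (max 0 (1 - c * (F x - m))) \<partial>G)"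
    by (intro nn_integral_eq_integral[symmetric] Bochner_Integration.integrable_max integrable_zero int) auto
  also have "\<dots> \<le> (\<integral>\<^sup>+x. ennreal (exp (- c * (F x - m))) \<partial>G)"
  proof (intro nn_integral_mono ennreal_leI)
    show "max 0 (1 - c * (F x - m)) \<le> exp (- c * (F x - m))" for x
      using exp_ge_add_one_self[of "- c * (F x - m)"] by simp
  qed
  also have "\<dots> = (\<integral>\<^sup>+x. u x \<partial>lborel)"
    by (simp add: G_def nn_integral_density u_def ennreal_mult' mult.commute)
  finally have u1: "1 \<le> (\<integral>\<^sup>+x. u x \<partial>lborel)" .
  \<comment> \<open>The integral of \<open>v\<close> may a priori be infinite, so the contradiction
    uses a finite \<open>r\<close> strictly between 1 and it, for which \<open>geo\<close> yields
    \<open>r powr s \<le> 1\<close>.\<close>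
  have v1: "(\<integral>\<^sup>+x. v x \<partial>lborel) \<le> 1"
  proof (rule ccontr)
    assume "\<not> (\<integral>\<^sup>+x. v x \<partial>lborel) \<le> 1"
    then obtain t where t: "1 < t" "t < (\<integral>\<^sup>+x. v x \<partial>lborel)"
      using dense not_le by metis
    then obtain r where r: "t = ennreal r" "0 \<le> r" by (cases t) auto
    have "1 < r" using t r by (simp flip: ennreal_1 add: ennreal_less_iff)
    then have "1 < r powr s" using powr_less_mono[OF s(1), of r] by simp
    moreover have "ennreal (1 powr (1 - s) * r powr s) \<le> 1"
      using t r u1 by (intro geo_leD[OF geo]) auto
    ultimately show False
      by (simp flip: ennreal_1 add: ennreal_le_iff)
  qed
  have "(\<integral>\<^sup>+x. ennreal (exp (l * (F x - m))) \<partial>G)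
      = (\<integral>\<^sup>+x. ennreal (exp k) * v x \<partial>lborel)"
    by (simp add: G_def nn_integral_density v_def mult.commute exp_diff flip: ennreal_mult')
  also have "\<dots> = ennreal (exp k) * (\<integral>\<^sup>+x. v x \<partial>lborel)"
    by (simp add: nn_integral_cmult)
  also have "\<dots> \<le> ennreal (exp k) * 1" by (intro mult_left_mono v1) simp
  finally show ?thesis by (simp add: m_def k_def)
qed

lemma exp_moment_lipschitz:
  assumes l: "0 \<le> l"
  shows "(\<integral>\<^sup>+x. ennreal (exp (l * (F x - (\<integral>y. F y \<partial>G)))) \<partial>G) \<le> ennreal (exp ((l * L * \<sigma>)\<^sup>2 / 2))"
proof (rule tendsto_lowerbound)
  have "((\<lambda>s. ennreal (exp ((l * L * \<sigma>)\<^sup>2 / 2 / (1 - s))))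
      \<longlongrightarrow> ennreal (exp ((l * L * \<sigma>)\<^sup>2 / 2 / (1 - 0)))) (at_right 0)"
    by (intro tendsto_intros) auto
  then show "((\<lambda>s. ennreal (exp ((l * L * \<sigma>)\<^sup>2 / 2 / (1 - s))))
      \<longlongrightarrow> ennreal (exp ((l * L * \<sigma>)\<^sup>2 / 2))) (at_right 0)" by simp
  show "\<forall>\<^sub>F s in at_right 0. (\<integral>\<^sup>+x. ennreal (exp (l * (F x - (\<integral>y. F y \<partial>G)))) \<partial>G)
      \<le> ennreal (exp ((l * L * \<sigma>)\<^sup>2 / 2 / (1 - s)))"
    unfolding eventually_at_right_field
    using exp_moment_lipschitz_aux[OF l] by (intro exI[of _ 1]) auto
qed simp

theorem gaussian_concentration:
  assumes "0 < L" "0 \<le> t"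
  shows "measure G {x. F x \<ge> (\<integral>y. F y \<partial>G) + t} \<le> exp (- t\<^sup>2 / (2 * \<sigma>\<^sup>2 * L\<^sup>2))"
proof -
  note [measurable] = lipschitz_borel_measurable[OF L lip]
  interpret prob_space G by (rule G)
  define m where "m = (\<integral>y. F y \<partial>G)"
  \<comment> \<open>The minimizer of the Chernoff exponent
    \<open>- l * t + (l * L * \<sigma>)\<^sup>2 / 2\<close>.\<close>
  define l where "l = t / (L\<^sup>2 * \<sigma>\<^sup>2)"
  have l: "0 \<le> l" using assms by (simp add: l_def)
  have sets_G [simp, measurable_cong]: "sets G = sets borel" by (simp add: G_def)
  have "emeasure G {x. F x \<ge> m + t} = (\<integral>\<^sup>+x. indicator {x. F x \<ge> m + t} x \<partial>G)"
    by (rule nn_integral_indicator[symmetric]) simp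
  also have "\<dots> \<le> (\<integral>\<^sup>+x. ennreal (exp (- l * t)) * ennreal (exp (l * (F x - m))) \<partial>G)"
  proof (intro nn_integral_mono)
    fix x
    have "0 \<le> - l * t + l * (F x - m)" if "F x \<ge> m + t"
      using mult_left_mono[OF that l] by (simp add: algebra_simps)
    then show "indicator {x. F x \<ge> m + t} x \<le> ennreal (exp (- l * t)) * ennreal (exp (l * (F x - m)))"
      by (auto simp: indicator_def simp flip: ennreal_mult' exp_add ennreal_1 intro!: ennreal_leI)
  qed
  also have "\<dots> = ennreal (exp (- l * t)) * (\<integral>\<^sup>+x. ennreal (exp (l * (F x - m))) \<partial>G)"
    by (rule nn_integral_cmult) simp
  also have "\<dots> \<le> ennreal (exp (- l * t)) * ennreal (exp ((l * L * \<sigma>)\<^sup>2 / 2))"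
    using exp_moment_lipschitz[OF l] by (intro mult_left_mono) (auto simp: m_def)
  also have "\<dots> = ennreal (exp (- t\<^sup>2 / (2 * \<sigma>\<^sup>2 * L\<^sup>2)))"
  proof -
    have "- l * t + (l * L * \<sigma>)\<^sup>2 / 2 = - t\<^sup>2 / (2 * \<sigma>\<^sup>2 * L\<^sup>2)"
      using assms \<sigma> by (simp add: l_def field_simps power2_eq_square)
    then show ?thesis by (simp flip: ennreal_mult' exp_add)
  qed
  finally show ?thesis
    by (simp add: emeasure_eq_measure ennreal_le_iff m_def)
qed

end

subsection \<open>The norms and the noise correlation\<close>

lemma powr_convex_combination:
  fixes x y a p :: real
  assumes "1 \<le> p" "0 \<le> a" "a \<le> 1" "0 \<le> x" "0 \<le> y"
  shows "((1 - a) * x + a * y) powr p \<le> (1 - a) * x powr p + a * y powr p"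
proof (cases "x = 0 \<or> y = 0")
  case True
  have *: "c powr p \<le> c" if "0 \<le> c" "c \<le> 1" for c :: real
    using powr_mono'[of 1 p c] that assms by auto
  from True show ?thesis
    using assms *[of a] *[of "1 - a"] by (auto simp: powr_mult mult_right_mono)
next
  case False
  then show ?thesis
    using convex_onD[OF powr_convex[OF assms(1)], of a x y] assms by auto
qed

lemma lq_norm_real:
  "lq_norm (ereal p) x = (\<Sum>j\<in>UNIV. \<bar>x $ j\<bar> powr p) powr (1 / p)"
  by (simp add: lq_norm_def)

lemma lq_norm_inf: "lq_norm \<infinity> x = Max (range (\<lambda>j. \<bar>x $ j\<bar>))"
  by (simp add: lq_norm_def)

lemma lq_norm_mono:
  assumes "1 \<le> q" "\<And>j. \<bar>x $ j\<bar> \<le> \<bar>y $ j\<bar>"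
  shows "lq_norm q x \<le> lq_norm q y"
proof (cases q)
  case (real p)
  then show ?thesis using assms
    by (auto simp: lq_norm_real intro!: powr_mono2 sum_mono sum_nonneg)
next
  case PInf
  have "\<bar>x $ j\<bar> \<le> Max (range (\<lambda>j. \<bar>y $ j\<bar>))" for j
    using assms(2)[of j] by (rule order_trans) simp
  then show ?thesis unfolding PInf lq_norm_inf by (subst Max_le_iff) auto
qed (use assms in auto)

lemma lq_norm_nonneg: "0 \<le> lq_norm q x"
proof -
  \<comment> \<open>Index types are nonempty, so \<open>undefined\<close> is some index and its
    entry bounds the maximum from below.\<close>
  have "0 \<le> \<bar>x $ undefined\<bar>" by simp
  also have "\<dots> \<le> Max (range (\<lambda>j. \<bar>x $ j\<bar>))" by (rule Max_ge) auto
  finally show ?thesis by (simp add: lq_norm_def)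
qed

lemma lq_norm_scaleR:
  assumes "1 \<le> q"
  shows "lq_norm q (c *\<^sub>R x) = \<bar>c\<bar> * lq_norm q x"
proof (cases q)
  case (real p)
  then have "(\<Sum>j\<in>UNIV. \<bar>(c *\<^sub>R x) $ j\<bar> powr p) = \<bar>c\<bar> powr p * (\<Sum>j\<in>UNIV. \<bar>x $ j\<bar> powr p)"
    by (simp add: abs_mult powr_mult sum_distrib_left)
  then show ?thesis using real assms
    by (simp add: lq_norm_real powr_mult powr_powr sum_nonneg)
next
  case PInf
  have "Max ((*) \<bar>c\<bar> ` range (\<lambda>j. \<bar>x $ j\<bar>)) = \<bar>c\<bar> * Max (range (\<lambda>j. \<bar>x $ j\<bar>))"
    by (rule mono_Max_commute[symmetric]) (auto intro!: monoI mult_left_mono)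
  then show ?thesis unfolding PInf lq_norm_inf by (simp add: image_image abs_mult)
qed (use assms in auto)

lemma lq_norm_uminus: "1 \<le> q \<Longrightarrow> lq_norm q (- x) = lq_norm q x"
  using lq_norm_scaleR[of q "-1" x] by simp

lemma lq_norm_eq_0_iff:
  assumes "1 \<le> q"
  shows "lq_norm q x = 0 \<longleftrightarrow> x = 0"
proof
  assume *: "lq_norm q x = 0"
  show "x = 0"
  proof (cases q)
    case (real p)
    then show ?thesis using *
      by (simp add: lq_norm_real sum_nonneg_eq_0_iff vec_eq_iff)
  next
    case PInf
    have "\<bar>x $ j\<bar> \<le> 0" for j
      using * Max_ge[of "range (\<lambda>j. \<bar>x $ j\<bar>)" "\<bar>x $ j\<bar>"] unfolding PInf lq_norm_inf by simp
    then show ?thesis by (simp add: vec_eq_iff)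
  qed (use assms in auto)
qed (use lq_norm_scaleR[OF assms, of 0] in simp)

text \<open>For finite \<open>q\<close>, \<open>(x + y) / (a + b)\<close> is a convex combination of
  \<open>x / a\<close> and \<open>y / b\<close>, which have norm one; coordinatewise convexity of
  the power keeps the sum of powers at most 1. Zero vectors are split off because of the
  division.\<close>

lemma lq_norm_triangle:
  assumes q: "1 \<le> q"
  shows "lq_norm q (x + y) \<le> lq_norm q x + lq_norm q y"
proof (cases q)
  case (real p)
  define a where "a = lq_norm q x"
  define b where "b = lq_norm q y"
  show ?thesis
  proof (cases "x = 0 \<or> y = 0")
    case True
    then show ?thesis using lq_norm_nonneg[of q x] lq_norm_nonneg[of q y] by auto
  next
    case False
    then have "a \<noteq> 0" "b \<noteq> 0" using lq_norm_eq_0_iff[OF q] by (auto simp: a_def b_def)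
    then have ab: "0 < a" "0 < b"
      using lq_norm_nonneg[of q x] lq_norm_nonneg[of q y] by (auto simp: a_def b_def)
    have p: "1 \<le> p" using q real by simp
    have unit: "(\<Sum>j\<in>UNIV. (\<bar>v $ j\<bar> / lq_norm q v) powr p) = 1" if "lq_norm q v > 0" for v :: "real ^ 'a"
    proof -
      have "lq_norm q v powr p = (\<Sum>j\<in>UNIV. \<bar>v $ j\<bar> powr p)"
        using p real by (simp add: lq_norm_real powr_powr sum_nonneg)
      moreover have "lq_norm q v powr p \<noteq> 0" using that by simp
      ultimately show ?thesis using that
        by (simp add: powr_divide flip: sum_divide_distrib)
    qed
    let ?t = "b / (a + b)"
    have t: "0 \<le> ?t" "?t \<le> 1" "1 - ?t = a / (a + b)" using ab by (auto simp: field_simps)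
    have "(\<Sum>j\<in>UNIV. (\<bar>(x + y) $ j\<bar> / (a + b)) powr p)
        \<le> (\<Sum>j\<in>UNIV. (1 - ?t) * (\<bar>x $ j\<bar> / a) powr p + ?t * (\<bar>y $ j\<bar> / b) powr p)"
    proof (rule sum_mono)
      fix j
      have "\<bar>(x + y) $ j\<bar> / (a + b) \<le> (\<bar>x $ j\<bar> + \<bar>y $ j\<bar>) / (a + b)"
        using ab by (intro divide_right_mono) (auto simp: abs_triangle_ineq)
      also have "\<dots> = (1 - ?t) * (\<bar>x $ j\<bar> / a) + ?t * (\<bar>y $ j\<bar> / b)"
        using ab unfolding t(3) by (simp add: add_divide_distrib)
      finally have "(\<bar>(x + y) $ j\<bar> / (a + b)) powr p
          \<le> ((1 - ?t) * (\<bar>x $ j\<bar> / a) + ?t * (\<bar>y $ j\<bar> / b)) powr p"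
        using p ab by (intro powr_mono2) auto
      also have "\<dots> \<le> (1 - ?t) * (\<bar>x $ j\<bar> / a) powr p + ?t * (\<bar>y $ j\<bar> / b) powr p"
        using p t ab by (intro powr_convex_combination) auto
      finally show "(\<bar>(x + y) $ j\<bar> / (a + b)) powr p
          \<le> (1 - ?t) * (\<bar>x $ j\<bar> / a) powr p + ?t * (\<bar>y $ j\<bar> / b) powr p" .
    qed
    also have "\<dots> = 1"
      using unit[of x, folded a_def] unit[of y, folded b_def] ab t(3)
      by (simp only: sum.distrib sum_distrib_left[symmetric])
    finally have "(\<Sum>j\<in>UNIV. (\<bar>(x + y) $ j\<bar> / (a + b)) powr p) powr (1 / p) \<le> 1 powr (1 / p)"
      using p by (intro powr_mono2) (auto intro: sum_nonneg)
    moreover have "(\<Sum>j\<in>UNIV. (\<bar>(x + y) $ j\<bar> / (a + b)) powr p) powr (1 / p)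
        = lq_norm q ((1 / (a + b)) *\<^sub>R (x + y))"
      using ab by (simp add: real lq_norm_real abs_mult)
    ultimately have "lq_norm q (x + y) / (a + b) \<le> 1"
      using ab by (simp add: lq_norm_scaleR[OF q])
    then show ?thesis using ab by (simp add: a_def b_def)
  qed
next
  case PInf
  have "\<bar>(x + y) $ j\<bar> \<le> lq_norm \<infinity> x + lq_norm \<infinity> y" for j
  proof -
    have "\<bar>x $ j\<bar> \<le> lq_norm \<infinity> x" "\<bar>y $ j\<bar> \<le> lq_norm \<infinity> y"
      by (auto simp: lq_norm_inf)
    then show ?thesis by (auto simp: abs_le_iff)
  qed
  then show ?thesis unfolding PInf lq_norm_inf[of "x + y"] by (subst Max_le_iff) auto
qed (use q in auto)

section \<open>Lipschitz bound for the noise correlation\<close>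

lemma noise_corr_eq_sum:
  fixes X :: "real ^ 'l ^ 'n"
  shows "noise_corr q X w = lq_norm q ((1 / real CARD('n)) *\<^sub>R (\<Sum>i\<in>UNIV. w $ i *\<^sub>R X $ i))"
proof -
  have "transpose X *v w = (\<Sum>i\<in>UNIV. w $ i *\<^sub>R X $ i)"
    by (simp add: vec_eq_iff matrix_vector_mult_def transpose_def mult.commute)
  then show ?thesis by (simp add: noise_corr_def)
qed

text \<open>Each coordinate of \<open>transpose X *v w\<close> is an inner product of
  \<open>w\<close> with a column of \<open>X\<close>, so Cauchy-Schwarz applies. A column has norm
  \<open>sqrt n\<close> times its root mean square, which leaves \<open>1 / sqrt n\<close> of the
  factor \<open>1 / n\<close>.\<close>

lemma noise_corr_le:
  fixes X :: "real ^ 'l ^ 'n"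
  assumes q: "1 \<le> q"
  shows "noise_corr q X w \<le> lq_norm q (column_rms X) / sqrt (real CARD('n)) * norm w"
proof -
  let ?n = "real CARD('n)"
  have "noise_corr q X w \<le> lq_norm q ((norm w / sqrt ?n) *\<^sub>R column_rms X)"
    unfolding noise_corr_def
  proof (rule lq_norm_mono[OF q])
    fix j
    have rms: "column_rms X $ j = norm (column j X) / sqrt ?n"
      by (simp add: column_rms_def norm_vec_def L2_set_def column_def real_sqrt_divide)
    have "(transpose X *v w) $ j = column j X \<bullet> w"
      by (simp add: matrix_vector_mult_def transpose_def column_def inner_vec_def)
    then have "\<bar>((1 / ?n) *\<^sub>R (transpose X *v w)) $ j\<bar> = \<bar>column j X \<bullet> w\<bar> / ?n"
      by (simp add: abs_mult)
    also have "\<dots> \<le> norm (column j X) * norm w / ?n"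
      by (intro divide_right_mono Cauchy_Schwarz_ineq2) simp
    also have "\<dots> = norm w / sqrt ?n * column_rms X $ j"
      by (simp add: rms)
    also have "\<dots> \<le> \<bar>((norm w / sqrt ?n) *\<^sub>R column_rms X) $ j\<bar>"
      by (simp only: vector_scaleR_component real_scaleR_def abs_ge_self)
    finally show "\<bar>((1 / ?n) *\<^sub>R (transpose X *v w)) $ j\<bar> \<le> \<bar>((norm w / sqrt ?n) *\<^sub>R column_rms X) $ j\<bar>" .
  qed
  also have "\<dots> = lq_norm q (column_rms X) / sqrt ?n * norm w"
    by (simp add: lq_norm_scaleR[OF q])
  finally show ?thesis .
qed

lemma noise_corr_diff_le:
  fixes X :: "real ^ 'l ^ 'n"
  assumes q: "1 \<le> q"
  shows "noise_corr q X w - noise_corr q X w'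
    \<le> lq_norm q (column_rms X) / sqrt (real CARD('n)) * norm (w - w')"
proof -
  have "(1 / real CARD('n)) *\<^sub>R (transpose X *v w)
      = (1 / real CARD('n)) *\<^sub>R (transpose X *v (w - w')) + (1 / real CARD('n)) *\<^sub>R (transpose X *v w')"
    by (simp add: algebra_simps matrix_vector_mult_diff_distrib)
  then have "noise_corr q X w \<le> noise_corr q X (w - w') + noise_corr q X w'"
    using lq_norm_triangle[OF q] unfolding noise_corr_def by metis
  then show ?thesis using noise_corr_le[OF q, of X "w - w'"] by linarith
qed

subsection \<open>The noise level and the program\<close>

text \<open>The constant \<open>Z\<close> is never evaluated: it is positive because the law of
  \<open>W\<close> has mass one, and \<open>ln Z\<close> serves as \<open>z\<close>.\<close>

lemma mv_normal_density_isotropic: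
  fixes W :: "'a \<Rightarrow> real ^ 'n"
  assumes "prob_space M" "0 < \<sigma>"
    and W: "distributed M lborel W (\<lambda>w. ennreal (mv_normal_density 0 (\<sigma>\<^sup>2 *\<^sub>R mat 1) w))"
  obtains z where "distr M lborel W = density lborel (\<lambda>w. ennreal (gauss \<sigma> z w))"
proof -
  interpret M: prob_space M by fact
  let ?S = "\<sigma>\<^sup>2 *\<^sub>R mat 1 :: real ^ 'n ^ 'n"
  define Z where "Z = sqrt ((2 * pi) ^ CARD('n) * det ?S)"
  let ?T = "(1 / \<sigma>\<^sup>2) *\<^sub>R mat 1 :: real ^ 'n ^ 'n"
  have prod: "?S ** ?T = mat 1" "?T ** ?S = mat 1"
    using assms(2) by (simp_all add: matrix_scalar_ac flip: scalar_matrix_assoc)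
  \<comment> \<open>\<open>matrix_inv\<close> is a Hilbert choice: the explicit \<open>?T\<close>
    shows that the chosen matrix is an inverse, and uniqueness of inverses identifies it with
    \<open>?T\<close>.\<close>
  then have "matrix_inv ?S ** ?S = mat 1"
    unfolding matrix_inv_def by (rule someI2[of _ ?T, OF conjI]) simp
  then have inv: "matrix_inv ?S = ?T"
    using prod by (metis matrix_mul_assoc matrix_mul_lid matrix_mul_rid)
  have dens: "mv_normal_density 0 ?S w = exp (- (norm w)\<^sup>2 / (2 * \<sigma>\<^sup>2)) / Z" for w
    by (simp add: mv_normal_density_def inv Z_def scaleR_matrix_vector_assoc[symmetric] power2_norm_eq_inner)
  have distr: "distr M lborel W = density lborel (\<lambda>w. ennreal (mv_normal_density 0 ?S w))"
    by (rule distributed_distr_eq_density[OF W])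
  have "Z > 0"
  proof (rule ccontr)
    assume "\<not> Z > 0"
    then have "ennreal (mv_normal_density 0 ?S w) = 0" for w
      unfolding dens by (intro ennreal_neg divide_nonneg_nonpos) auto
    then have "emeasure (distr M lborel W) UNIV = 0"
      unfolding distr by (simp add: emeasure_density)
    moreover have "prob_space (distr M lborel W)"
      by (rule M.prob_space_distr[OF distributed_measurable[OF W]])
    then have "emeasure (distr M lborel W) UNIV = 1"
      using prob_space.emeasure_space_1 by fastforce
    ultimately show False by simp
  qed
  then have "mv_normal_density 0 ?S w = gauss \<sigma> (ln Z) w" for w
    by (simp add: dens gauss_def exp_diff)
  with distr that show thesis by simp
qed

text \<open>Concentration is applied to the law of \<open>W\<close> and pulled back; with Lipschitz
  constant \<open>L = R / sqrt n\<close>, the quotient \<open>t\<^sup>2 / L\<^sup>2\<close> becomes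
  \<open>n * t\<^sup>2 / R\<^sup>2\<close>.\<close>

lemma noise_corr_concentration:
  fixes X :: "real ^ 'l ^ 'n" and W :: "'a \<Rightarrow> real ^ 'n"
    and q :: ereal
  defines "R \<equiv> lq_norm q (column_rms X)"
  assumes M: "prob_space M" and \<sigma>: "0 < \<sigma>"
    and W: "distributed M lborel W (\<lambda>w. ennreal (mv_normal_density 0 (\<sigma>\<^sup>2 *\<^sub>R mat 1) w))"
    and q: "1 \<le> q" and R: "0 < R" and t: "0 \<le> t"
  shows "measure M {\<omega> \<in> space M.
        noise_corr q X (W \<omega>) \<ge> (\<integral>\<omega>'. noise_corr q X (W \<omega>') \<partial>M) + t}
      \<le> exp (- (real CARD('n) * t\<^sup>2) / (2 * \<sigma>\<^sup>2 * (R)\<^sup>2))"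
proof -
  interpret prob_space M by (rule M)
  obtain z where distr: "distr M lborel W = density lborel (\<lambda>w. ennreal (gauss \<sigma> z w))"
    using mv_normal_density_isotropic[OF M \<sigma> W] .
  let ?G = "density lborel (\<lambda>w. ennreal (gauss \<sigma> z w)) :: (real ^ 'n) measure"
  let ?L = "R / sqrt (real CARD('n))"
  have W_meas: "W \<in> measurable M lborel" by (rule distributed_measurable[OF W])
  then have [measurable]: "W \<in> borel_measurable M" by simp
  have G: "prob_space ?G" unfolding distr[symmetric] by (rule prob_space_distr[OF W_meas])
  have L: "0 < ?L" using R by simp
  have lip: "noise_corr q X w - noise_corr q X w' \<le> ?L * norm (w - w')" for w w'
    unfolding R_def by (rule noise_corr_diff_le[OF q])
  have [measurable]: "noise_corr q X \<in> borel_measurable borel"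
    by (rule lipschitz_borel_measurable[OF less_imp_le[OF L] lip])
  have mean: "(\<integral>w. noise_corr q X w \<partial>?G) = (\<integral>\<omega>. noise_corr q X (W \<omega>) \<partial>M)"
    unfolding distr[symmetric] by (rule integral_distr[OF W_meas]) simp
  have "measure M {\<omega> \<in> space M. noise_corr q X (W \<omega>) \<ge> (\<integral>\<omega>'. noise_corr q X (W \<omega>') \<partial>M) + t}
      = measure ?G {w. noise_corr q X w \<ge> (\<integral>w. noise_corr q X w \<partial>?G) + t}"
    unfolding mean unfolding distr[symmetric]
    by (subst measure_distr) (auto intro!: arg_cong2[where f=measure])
  also have "\<dots> \<le> exp (- t\<^sup>2 / (2 * \<sigma>\<^sup>2 * ?L\<^sup>2))"
    by (rule gaussian_concentration[OF \<sigma> G less_imp_le[OF L] lip L t])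
  also have "- t\<^sup>2 / (2 * \<sigma>\<^sup>2 * ?L\<^sup>2) = - (real CARD('n) * t\<^sup>2) / (2 * \<sigma>\<^sup>2 * (R)\<^sup>2)"
    by (simp add: power_divide)
  finally show ?thesis .
qed

text \<open>Covers the degenerate case, in which the exponent of the tail bound would divide by
  zero.\<close>

lemma noise_corr_column_rms_0:
  assumes "1 \<le> q" "lq_norm q (column_rms X) = 0"
  shows "noise_corr q X w = 0"
proof (rule antisym)
  show "noise_corr q X w \<le> 0"
    using noise_corr_le[OF assms(1), of X w] assms(2) by simp
qed (simp add: noise_corr_def lq_norm_nonneg)

section \<open>Deterministic bounds for optimal solutions\<close>

text \<open>This concerns one realization \<open>w\<close> of the noise: minimality gives the lower
  bound on \<open>\<Delta>\<close>, feasibility the upper one.\<close>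

lemma optimal_solution_bounds:
  fixes X :: "real ^ 'l ^ 'n" and V :: "real ^ 'k ^ 'n" and g :: "real ^ 'k \<Rightarrow> real ^ 'p \<Rightarrow> real"
    and q :: ereal and \<theta>s \<theta> :: "real ^ 'p"
  defines "\<Delta> \<equiv> lq_norm q ((1 / real CARD('n)) *\<^sub>R
      (\<Sum>i\<in>UNIV. (g (V $ i) \<theta>s - g (V $ i) \<theta>) *\<^sub>R X $ i))"
  assumes q: "1 \<le> q"
    and y: "\<And>i. y $ i = g (V $ i) \<theta>s + w $ i"
    and noise: "noise_corr q X w \<le> r"
    and opt: "optimal_solution g h \<Omega> V X y q r (\<theta>, \<mu>)"
  shows "\<mu> \<le> \<Delta>" "\<Delta> \<le> 2 * r + \<mu>"
proof -
  let ?c = "1 / real CARD('n)"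
  define d where "d = ?c *\<^sub>R (\<Sum>i\<in>UNIV. (g (V $ i) \<theta>s - g (V $ i) \<theta>) *\<^sub>R X $ i)"
  define e where "e = ?c *\<^sub>R (\<Sum>i\<in>UNIV. w $ i *\<^sub>R X $ i)"
  have \<Delta>: "\<Delta> = lq_norm q d" by (simp add: \<Delta>_def d_def)
  have e: "lq_norm q e \<le> r" using noise by (simp add: noise_corr_eq_sum e_def)
  have res: "?c *\<^sub>R (\<Sum>i\<in>UNIV. (y $ i - g (V $ i) \<theta>) *\<^sub>R X $ i) = d + e"
    by (simp add: y d_def e_def algebra_simps flip: sum.distrib scaleR_add_right)
  have feas: "lq_norm q (d + e) \<le> r + \<mu>" "h \<theta> \<in> \<Omega>" "0 \<le> \<mu>"
    using opt by (auto simp: optimal_solution_def is_arg_min_def feasible_def res)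
  \<comment> \<open>\<open>is_arg_min\<close> excludes feasible points with a strictly smaller
    objective. Competitors keep the same \<open>\<theta>\<close>, so
    \<open>h \<theta> \<in> \<Omega>\<close> carries over.\<close>
  have least: "\<not> \<mu>' < \<mu>" if "lq_norm q (d + e) \<le> r + \<mu>'" "0 \<le> \<mu>'" for \<mu>'
    using opt that by (auto simp: optimal_solution_def is_arg_min_def feasible_def res)
  have "lq_norm q (d + e) \<le> r + lq_norm q d"
    using lq_norm_triangle[OF q, of d e] e by linarith
  then show "\<mu> \<le> \<Delta>"
    using least[of "lq_norm q d"] lq_norm_nonneg[of q d] by (simp add: \<Delta>)
  have "lq_norm q d \<le> lq_norm q (d + e) + lq_norm q e"
    using lq_norm_triangle[OF q, of "d + e" "- e"] by (simp add: lq_norm_uminus[OF q])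
  then show "\<Delta> \<le> 2 * r + \<mu>"
    using feas(1) e by (simp add: \<Delta>)
qed

text \<open>When \<open>column_rms X\<close> has norm zero, division by zero would make the exponent
  0; the \<open>if\<close> puts there the limiting bound 0 for \<open>t > 0\<close>. An optimal pair
  depends on \<open>\<omega>\<close> through a choice that may fail to be measurable, so the
  probability is stated through an event \<open>A\<close> on which every optimal pair obeys both
  bounds.\<close>

theorem proposition2p1:
  fixes M :: "'a measure"
    and V :: "real ^ 'k ^ 'n"
    and f :: "real ^ 'k \<Rightarrow> real ^ 'l"
    and X :: "real ^ 'l ^ 'n"
    and g :: "real ^ 'k \<Rightarrow> real ^ 'p \<Rightarrow> real"
    and h :: "real ^ 'p \<Rightarrow> real ^ 'm"
    and \<Omega> :: "(real ^ 'm) set"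
    and \<theta>s :: "real ^ 'p"
    and W Y :: "'a \<Rightarrow> real ^ 'n"
    and \<sigma> :: real
    and q :: ereal
  assumes "prob_space M"
    and "\<sigma> > 0"
    and "\<And>i. X $ i = f (V $ i)"
    and "distributed M lborel W (\<lambda>w. ennreal (mv_normal_density 0 (\<sigma>\<^sup>2 *\<^sub>R mat 1) w))"
    and "\<And>\<omega> i. \<omega> \<in> space M \<Longrightarrow> Y \<omega> $ i = g (V $ i) \<theta>s + W \<omega> $ i"
    and "closed \<Omega>" and "\<Omega> \<noteq> {}"
    and "{\<theta>. h \<theta> \<in> \<Omega>} \<noteq> {}"
    and "1 \<le> q"
  shows
    "(\<forall>t\<ge>0.
        measure M {\<omega> \<in> space M.
            noise_corr q X (W \<omega>) \<ge> (\<integral>\<omega>'. noise_corr q X (W \<omega>') \<partial>M) + t}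
        \<le> (if lq_norm q (column_rms X) = 0 \<and> t > 0 then 0
            else exp (- (real CARD('n) * t\<^sup>2) / (2 * \<sigma>\<^sup>2 * (lq_norm q (column_rms X))\<^sup>2))))
     \<and> (\<forall>\<alpha>. 0 < \<alpha> \<and> \<alpha> < 1 \<longrightarrow>
        (\<exists>A\<in>sets M. measure M A \<ge> 1 - \<alpha> \<and>
          (\<forall>\<omega>\<in>A. \<forall>\<theta> \<mu>. optimal_solution g h \<Omega> V X (Y \<omega>) q (r_star M W X \<sigma> q \<alpha>) (\<theta>, \<mu>) \<longrightarrow>
             lq_norm q ((1 / real CARD('n)) *\<^sub>R
                 (\<Sum>i\<in>UNIV. (g (V $ i) \<theta>s - g (V $ i) \<theta>) *\<^sub>R X $ i)) \<ge> \<mu> \<and>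
             lq_norm q ((1 / real CARD('n)) *\<^sub>R
                 (\<Sum>i\<in>UNIV. (g (V $ i) \<theta>s - g (V $ i) \<theta>) *\<^sub>R X $ i))
               \<le> 2 * r_star M W X \<sigma> q \<alpha> + \<mu>)))"
proof -
  interpret prob_space M by fact
  define R where "R = lq_norm q (column_rms X)"
  define m where "m = (\<integral>\<omega>. noise_corr q X (W \<omega>) \<partial>M)"
  have q: "1 \<le> q" by fact
  have R_nonneg: "0 \<le> R" by (simp add: R_def lq_norm_nonneg)
  have [measurable]: "W \<in> borel_measurable M"
    using distributed_measurable[OF assms(4)] by simp
  have "0 \<le> lq_norm q (column_rms X) / sqrt (real CARD('n))" by (simp add: lq_norm_nonneg)
  then have [measurable]: "noise_corr q X \<in> borel_measurable borel"
    by (rule lipschitz_borel_measurable[OF _ noise_corr_diff_le[OF q]])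
  have tail: "measure M {\<omega> \<in> space M. noise_corr q X (W \<omega>) \<ge> m + t}
      \<le> (if R = 0 \<and> t > 0 then 0 else exp (- (real CARD('n) * t\<^sup>2) / (2 * \<sigma>\<^sup>2 * R\<^sup>2)))"
    if t: "0 \<le> t" for t
  proof (cases "R = 0")
    \<comment> \<open>Noise and mean both vanish here: the event is empty for \<open>t > 0\<close>,
      and for \<open>t = 0\<close> the bound is \<open>exp 0 = 1\<close>.\<close>
    case True
    then have noise: "noise_corr q X w = 0" for w
      using noise_corr_column_rms_0[OF q] by (simp add: R_def)
    show ?thesis
    proof (cases "t = 0")
      case False
      then have "{\<omega> \<in> space M. noise_corr q X (W \<omega>) \<ge> m + t} = {}"
        using t by (simp add: noise m_def)
      then show ?thesis using True t False by (simp only: measure_empty) simp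
    qed (simp add: True)
  next
    case False
    then show ?thesis
      using noise_corr_concentration[OF assms(1,2,4) q _ t, of X] R_nonneg
      by (simp add: R_def m_def)
  qed
  have prob: "\<exists>A\<in>sets M. measure M A \<ge> 1 - \<alpha> \<and>
      (\<forall>\<omega>\<in>A. \<omega> \<in> space M \<and> noise_corr q X (W \<omega>) \<le> r_star M W X \<sigma> q \<alpha>)"
    if \<alpha>: "0 < \<alpha>" "\<alpha> < 1" for \<alpha>
  proof (intro bexI conjI ballI)
    \<comment> \<open>For nonzero \<open>R\<close>, this \<open>t\<close> solves \<open>n *
      t\<^sup>2 / (2 * \<sigma>\<^sup>2 * R\<^sup>2) = ln (1 / \<alpha>)\<close>, which makes the
      tail bound equal to \<open>\<alpha>\<close>.\<close>
    define e where "e = ln (1 / \<alpha>)"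
    define t where "t = \<sigma> * R * sqrt (2 / real CARD('n) * e)"
    have r: "r_star M W X \<sigma> q \<alpha> = m + t"
      unfolding r_star_def m_def R_def t_def e_def ..
    have e: "0 < e" "exp (- e) = \<alpha>" using \<alpha> by (simp_all add: e_def ln_div)
    have t: "0 \<le> t" using R_nonneg assms(2) e unfolding t_def by (intro mult_nonneg_nonneg) auto
    let ?A = "{\<omega> \<in> space M. noise_corr q X (W \<omega>) \<le> r_star M W X \<sigma> q \<alpha>}"
    let ?B = "{\<omega> \<in> space M. noise_corr q X (W \<omega>) \<ge> m + t}"
    show "?A \<in> sets M" by measurable
    show "1 - \<alpha> \<le> measure M ?A"
    proof (cases "R = 0")
      case True
      then have noise: "noise_corr q X w = 0" for w
        using noise_corr_column_rms_0[OF q] by (simp add: R_def)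
      have "?A = space M" using True by (simp add: r t_def m_def noise)
      then show ?thesis using \<alpha> by (simp add: prob_space)
    next
      case False
      have "(sqrt (2 / real CARD('n) * e))\<^sup>2 = 2 / real CARD('n) * e"
        using e by simp
      then have "real CARD('n) * t\<^sup>2 = 2 * \<sigma>\<^sup>2 * R\<^sup>2 * e"
        by (simp add: t_def power_mult_distrib)
      then have "- (real CARD('n) * t\<^sup>2) / (2 * \<sigma>\<^sup>2 * R\<^sup>2) = - e"
        using False assms(2) by simp
      then have B: "measure M ?B \<le> \<alpha>" using tail[OF t] False e(2) by simp
      have "1 - measure M ?B = measure M (space M - ?B)"
        by (rule prob_compl[symmetric]) measurable
      also have "\<dots> \<le> measure M ?A"
        by (rule finite_measure_mono) (auto simp: r)
      finally show ?thesis using B by simp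
    qed
  qed auto
  show ?thesis
  proof (intro conjI allI impI, goal_cases)
    case (1 t)
    then show ?case unfolding R_def[symmetric] m_def[symmetric] by (rule tail)
  next
    case (2 \<alpha>)
    then have "0 < \<alpha>" "\<alpha> < 1" by simp_all
    from prob[OF this] obtain A where A: "A \<in> sets M" "1 - \<alpha> \<le> measure M A"
      and A_noise: "\<forall>\<omega>\<in>A. \<omega> \<in> space M \<and> noise_corr q X (W \<omega>) \<le> r_star M W X \<sigma> q \<alpha>"
      by (elim bexE conjE)
    show ?case
    proof (intro bexI[of _ A] conjI A ballI allI impI)
      fix \<omega> \<theta> \<mu> assume \<omega>: "\<omega> \<in> A"
        and opt: "optimal_solution g h \<Omega> V X (Y \<omega>) q (r_star M W X \<sigma> q \<alpha>) (\<theta>, \<mu>)"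
      have "\<omega> \<in> space M" and noise: "noise_corr q X (W \<omega>) \<le> r_star M W X \<sigma> q \<alpha>"
        using A_noise \<omega> by simp_all
      note bounds = optimal_solution_bounds[OF q assms(5)[OF this(1)] noise opt]
      show "lq_norm q ((1 / real CARD('n)) *\<^sub>R
          (\<Sum>i\<in>UNIV. (g (V $ i) \<theta>s - g (V $ i) \<theta>) *\<^sub>R X $ i)) \<ge> \<mu>"
        by (rule bounds(1))
      show "lq_norm q ((1 / real CARD('n)) *\<^sub>R
          (\<Sum>i\<in>UNIV. (g (V $ i) \<theta>s - g (V $ i) \<theta>) *\<^sub>R X $ i))
          \<le> 2 * r_star M W X \<sigma> q \<alpha> + \<mu>"
        by (rule bounds(2))
    qed
  qed
qed

end
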